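(* Let $X$ be a finite biquandle, let $A$ be an abelian group, and let $\phi:X\to A$ be a biquandle $1$-fare. Let $L$ be an oriented classical or virtual knot, link or multi-knotoid. Then the multiset of fare values over the biquandle homset is invariant under Reidemeister moves. That is, if $D$ and $D'$ are two oriented diagrams of $L$ related by a finite sequence of oriented Reidemeister moves, then the multisets $$\{\phi(f)\ :\ f \text{ an } X\text{-coloring of } D\}\quad\text{and}\quad \{\phi(f')\ :\ f' \text{ an } X\text{-coloring of } D'\}$$ of elements of $A$, where $\phi(f)$ denotes the total fare (sum of $\phi$ over the colors of all semiarcs) of the colored diagram, are equal.
   Context: **Biquandle.** A biquandle is a set $X$ with two binary operations $\underline{\triangleright},\overline{\triangleright}:X\times X\to X$ such that: (i) $x\,\underline{\triangleright}\,x=x\,\overline{\triangleright}\,x$ for all $x\in X$; (ii) for all $y\in X$ the maps $\alpha_y(x)=x\,\overline{\triangleright}\,y$ and $\beta_y(x)=x\,\underline{\triangleright}\,y$ from $X$ to $X$ are invertible, and the map $S:X\times X\to X\times X$, $S(x,y)=(y\,\overline{\triangleright}\,x,\ x\,\underline{\triangleright}\,y)$, is invertible; (iii) for all $x,y,z\in X$, $(x\,\underline{\triangleright}\,y)\,\underline{\triangleright}\,(z\,\underline{\triangleright}\,y)=(x\,\underline{\triangleright}\,z)\,\underline{\triangleright}\,(y\,\overline{\triangleright}\,z)$, $(x\,\underline{\triangleright}\,y)\,\overline{\triangleright}\,(z\,\underline{\triangleright}\,y)=(x\,\overline{\triangleright}\,z)\,\underline{\triangleright}\,(y\,\overline{\triangleright}\,z)$,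 $(x\,\overline{\triangleright}\,y)\,\overline{\triangleright}\,(z\,\overline{\triangleright}\,y)=(x\,\overline{\triangleright}\,z)\,\overline{\triangleright}\,(y\,\underline{\triangleright}\,z)$. **Diagrams and moves.** Diagrams are oriented. Virtual diagrams may have virtual crossings in addition to classical ones, and for them "Reidemeister moves" means the classical moves I, II, III together with the usual virtual and mixed moves (equivalently, the detour move). A multi-knotoid diagram is a generic immersion in the sphere of one oriented segment and finitely many oriented circles, with over/under information at double points (possibly with virtual crossings in the virtual case). Its Reidemeister moves take place away from the two endpoints of the segment; passing a strand over or under an endpoint is not allowed. **Semiarcs.** Regard a diagram as a directed graph whose vertices are the classical crossings (and the endpoints of the segment in the multi-knotoid case); virtual crossings are not vertices. The semiarcs are the edges of this graph. A closed component without classical crossings contributes no edge to the fare sum, although it still receives a color. **$X$-colorings and homset.** An $X$-coloring of a diagram $D$ assigns an element of $X$ to each semiarc (and to each crossingless closed component), with colors unchanged through virtual crossings, such that at each classical crossing there are $x,y\in X$ with the following colors: - positive crossing: the understrand goes from $x$ (incoming) to $x\,\underline{\triangleright}\,y$ (outgoing), and the overstrand goes from $y\,\overline{\triangleright}\,x$ (incoming) to $y$ (outgoing); - negative crossing: the understrand goes from $x\,\underline{\triangleright}\,y$ (incoming) to $x$ (outgoing), and the overstrand goes from $y$ (incoming) to $y\,\overline{\triangleright}\,x$ (outgoing). The set of $X$-colorings of a diagram of $L$ is identified with the biquandle homset $\mathrm{Hom}(\mathcal{B}(L),X)$. For each Reidemeister move, every $X$-coloring before the move corresponds to a unique $X$-coloring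 after the move agreeing with it outside the neighborhood of the move. **Biquandle $1$-fare.** A biquandle fare of order $1$ ($1$-fare) with coefficients in $A$ is a function $\phi:X\to A$ such that: (i) for all $x\in X$, $\phi(x\,\underline{\triangleright}\,x)+\phi(x)=0$; (ii) for all $x,y\in X$, $\phi(x)+\phi(y)+\phi(x\,\underline{\triangleright}\,y)+\phi(y\,\overline{\triangleright}\,x)=0$; (iii) for all $x,y,z\in X$, $$\phi(y)+\phi(x\,\underline{\triangleright}\,y)+\phi(z\,\overline{\triangleright}\,y)=\phi(z\,\overline{\triangleright}\,x)+\phi(x\,\underline{\triangleright}\,z)+\phi\big((y\,\overline{\triangleright}\,x)\,\underline{\triangleright}\,(z\,\overline{\triangleright}\,x)\big).$$ **Total fare.** For an $X$-coloring $f$ of $D$, the total fare is $\phi(f)=\sum_{s}\phi(f(s))\in A$, summed over all semiarcs $s$ of $D$, that is, over all edges of the directed graph whose vertices are the classical crossings of $D$ (and the endpoints of the segment in the multi-knotoid case), with closed components without classical crossings contributing nothing to the sum. *)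

theory Defs
  imports "HOL-Library.Multiset" "HOL-Library.FuncSet"
begin

text \<open>The operations \<open>und\<close> and \<open>ovr\<close> are the triangle with a bar below and above, respectively.\<close>

locale biquandle =
  fixes X :: "'x set"
    and und ovr :: "'x \<Rightarrow> 'x \<Rightarrow> 'x"
  assumes diag: "x \<in> X \<Longrightarrow> und x x = ovr x x"
    and ovr_bij: "y \<in> X \<Longrightarrow> bij_betw (\<lambda>x. ovr x y) X X"
    and und_bij: "y \<in> X \<Longrightarrow> bij_betw (\<lambda>x. und x y) X X"
    and switch_bij: "bij_betw (\<lambda>(x, y). (ovr y x, und x y)) (X \<times> X) (X \<times> X)"
    and und_und: "\<lbrakk>x \<in> X; y \<in> X; z \<in> X\<rbrakk> \<Longrightarrow>
      und (und x y) (und z y) = und (und x z) (ovr y z)"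
    and und_ovr: "\<lbrakk>x \<in> X; y \<in> X; z \<in> X\<rbrakk> \<Longrightarrow>
      ovr (und x y) (und z y) = und (ovr x z) (ovr y z)"
    and ovr_ovr: "\<lbrakk>x \<in> X; y \<in> X; z \<in> X\<rbrakk> \<Longrightarrow>
      ovr (ovr x y) (ovr z y) = ovr (ovr x z) (und y z)"

definition fare1 :: "'x set \<Rightarrow> ('x \<Rightarrow> 'x \<Rightarrow> 'x) \<Rightarrow> ('x \<Rightarrow> 'x \<Rightarrow> 'x) \<Rightarrow> ('x \<Rightarrow> 'a::ab_group_add) \<Rightarrow> bool"
  where "fare1 X und ovr \<phi> \<longleftrightarrow>
    (\<forall>x\<in>X. \<phi> (und x x) + \<phi> x = 0) \<and>
    (\<forall>x\<in>X. \<forall>y\<in>X. \<phi> x + \<phi> y + \<phi> (und x y) + \<phi> (ovr y x) = 0) \<and>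
    (\<forall>x\<in>X. \<forall>y\<in>X. \<forall>z\<in>X.
      \<phi> y + \<phi> (und x y) + \<phi> (ovr z y) =
      \<phi> (ovr z x) + \<phi> (und x z) + \<phi> (und (ovr y x) (ovr z x)))"

text \<open>
  Oriented diagrams on the sphere are given by the cell structure of their underlying graphs.
  A diagram is a multiset of vertices, each naming the oriented edges at it (labelled by
  natural numbers). In \<open>Cross k sw se ne nw\<close> the crossing is drawn with both strands
  pointing upwards: they run from \<open>sw\<close> to \<open>ne\<close> and from \<open>se\<close> to \<open>nw\<close>. The strand from
  \<open>sw\<close> to \<open>ne\<close> is the overstrand at a positive crossing and the understrand at a negative one.

  \<open>Tail\<close> and \<open>Head\<close> are the initial and the terminal endpoint of the segment. \<open>Joint a b\<close> is
  not a feature of the drawn diagram: it is a point subdividing an edge into \<open>a\<close> followed by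
  \<open>b\<close>. In particular \<open>Joint a a\<close> is a circle without crossings.

  The placement of the connected parts of a disconnected diagram relative to each other is not
  recorded, so a move may join any two of them. The equivalence below thus contains the one
  induced by drawn diagrams.
\<close>

datatype kind = Positive | Negative | Virtual

datatype 'e vertex =
    Cross kind 'e 'e 'e 'e
  | Joint 'e 'e
  | Tail 'e
  | Head 'e

type_synonym diagram = "nat vertex multiset"

text \<open>The two ends of an edge: \<open>Start e\<close> lies at the vertex that \<open>e\<close> leaves,
  \<open>End e\<close> at the vertex that it enters.\<close>

datatype 'e dart = Start 'e | End 'e

fun flip :: "'e dart \<Rightarrow> 'e dart" where
  "flip (Start e) = End e"
| "flip (End e) = Start e"

text \<open>The darts at a vertex, in counterclockwise order.\<close>

fun rotation :: "'e vertex \<Rightarrow> 'e dart list" where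
  "rotation (Cross k sw se ne nw) = [End sw, End se, Start ne, Start nw]"
| "rotation (Joint a b) = [End a, Start b]"
| "rotation (Tail a) = [Start a]"
| "rotation (Head a) = [End a]"

definition dart_mset :: "diagram \<Rightarrow> nat dart multiset"
  where "dart_mset D = (\<Sum>v\<in>#D. mset (rotation v))"

definition darts :: "diagram \<Rightarrow> nat dart set"
  where "darts D = set_mset (dart_mset D)"

definition edges :: "diagram \<Rightarrow> nat set"
  where "edges D = {e. Start e \<in> darts D}"

definition well_formed :: "diagram \<Rightarrow> bool"
  where "well_formed D \<longleftrightarrow>
    (\<forall>e. count (dart_mset D) (Start e) = count (dart_mset D) (End e) \<and>
         count (dart_mset D) (Start e) \<le> 1)"

definition equiv_hull :: "('b \<times> 'b) set \<Rightarrow> ('b \<times> 'b) set"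
  where "equiv_hull r = (r \<union> r\<inverse>)\<^sup>*"

definition next_dart :: "diagram \<Rightarrow> (nat dart \<times> nat dart) set"
  where "next_dart D = (\<Union>v\<in>set_mset D. set (zip (rotation v) (rotate1 (rotation v))))"

definition faces :: "diagram \<Rightarrow> nat dart set set"
  where "faces D = darts D // equiv_hull {(d, d'). (flip d, d') \<in> next_dart D}"

definition connected_parts :: "diagram \<Rightarrow> nat dart set set"
  where "connected_parts D = darts D // equiv_hull (next_dart D \<union> {(d, flip d) | d. d \<in> darts D})"

text \<open>Euler's formula \<open>V - E + F = 2 C\<close>: every connected part of the graph, virtual crossings
  included among the vertices, is cellularly embedded in a sphere.\<close>

definition spherical :: "diagram \<Rightarrow> bool"
  where "spherical D \<longleftrightarrow>
    size D + card (faces D) = card (edges D) + 2 * card (connected_parts D)"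

text \<open>At most one segment: with none, \<open>D\<close> is a diagram of a knot or link, with one it is a
  multi-knotoid diagram. \<open>D\<close> is classical if it has no \<open>Virtual\<close> crossing.\<close>

definition oriented_diagram :: "diagram \<Rightarrow> bool"
  where "oriented_diagram D \<longleftrightarrow>
    well_formed D \<and> spherical D \<and> size {#v \<in># D. \<exists>a. v = Tail a#} \<le> 1"


fun opposite :: "kind \<Rightarrow> kind" where
  "opposite Positive = Negative"
| "opposite Negative = Positive"
| "opposite Virtual = Virtual"

text \<open>
  For three pairwise crossing strands 1, 2, 3, the argument \<open>k12\<close> says whether strand 1 is above
  strand 2 (\<open>Positive\<close>), below it (\<open>Negative\<close>) or crosses it virtually, and \<open>k23\<close>, \<open>k31\<close>
  likewise. Three classical crossings must not stack the strands cyclically; otherwise one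
  strand has to be virtual at both of its crossings. A triangle with exactly one virtual crossing
  belongs to a forbidden move.
\<close>

definition triangle_kinds :: "kind \<Rightarrow> kind \<Rightarrow> kind \<Rightarrow> bool"
  where "triangle_kinds k12 k23 k31 \<longleftrightarrow>
    (Virtual \<notin> {k12, k23, k31} \<and> \<not> (k12 = k23 \<and> k23 = k31)) \<or>
    (k12 = Virtual \<and> k23 = Virtual) \<or> (k23 = Virtual \<and> k31 = Virtual) \<or>
    (k31 = Virtual \<and> k12 = Virtual)"

text \<open>
  The two sides of each move inside a disc. The edges ending on the boundary of the disc are the
  ones occurring on both sides. With all crossing kinds allowed, these are the classical, virtual
  and mixed moves in all orientations:
  \<^item> \<open>R1\<close>: the curl lies to the right or to the left of the strand;
  \<^item> \<open>R2\<close>: the strand \<open>a b\<close> to the left of the strand \<open>c d\<close> running in the same direction, to the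
    left of it running in the opposite direction, and to the right of it running in the
    opposite direction;
  \<^item> \<open>R3\<close>: boundary orientations in-in-in-out-out-out (three upward strands, numbered from the left
    at the bottom) or alternating. Up to rotating the disc there are no others.
\<close>

inductive local_move :: "diagram \<Rightarrow> diagram \<Rightarrow> bool" where
  R1_right: "local_move {#Joint a b#} {#Cross k a c c b#}"
| R1_left: "local_move {#Joint a b#} {#Cross k c a b c#}"
| R2_parallel: "local_move {#Joint a b, Joint c d#}
    {#Cross k a c x y, Cross (opposite k) y x d b#}"
| R2_antiparallel_left: "local_move {#Joint a b, Joint c d#}
    {#Cross k y a d x, Cross (opposite k) x c b y#}"
| R2_antiparallel_right: "local_move {#Joint a b, Joint c d#}
    {#Cross k a y x d, Cross (opposite k) c x y b#}"
| R3_braid: "triangle_kinds k12 k23 (opposite k13) \<Longrightarrow> local_move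
    {#Cross k12 a1 a2 p q, Cross k13 p a3 b1 r, Cross k23 q r b2 b3#}
    {#Cross k23 a2 a3 s t, Cross k13 a1 t u b3, Cross k12 u s b1 b2#}"
| R3_alternating: "triangle_kinds k12 k23 k31 \<Longrightarrow> local_move
    {#Cross k12 p a2 b1 q, Cross k23 q a3 b2 r, Cross k31 r a1 b3 p#}
    {#Cross k12 a1 t s b2, Cross k23 a2 u t b3, Cross k31 a3 s u b1#}"

text \<open>The first two clauses do not change the drawn diagram. Since vertices \<open>Tail\<close> and \<open>Head\<close> do
  not occur in a local move, all moves are away from the endpoints.\<close>

inductive move :: "diagram \<Rightarrow> diagram \<Rightarrow> bool" where
  relabel: "inj_on f (edges D) \<Longrightarrow> move D (image_mset (map_vertex f) D)"
| unjoin: "a \<noteq> b \<Longrightarrow> move (M + {#Joint a b#}) (image_mset (map_vertex (id(b := a))) M)"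
| reidemeister: "local_move L R \<Longrightarrow> move (M + L) (M + R)"

definition reidemeister_equivalent :: "diagram \<Rightarrow> diagram \<Rightarrow> bool"
  where "reidemeister_equivalent =
    equivclp (\<lambda>D D'. oriented_diagram D \<and> oriented_diagram D' \<and> move D D')"


text \<open>Edges are glued along joints and virtual crossings to form the arcs that carry a single
  color: the semiarcs and the closed components without classical crossings.\<close>

definition passes :: "diagram \<Rightarrow> (nat \<times> nat) set"
  where "passes D = {(a, b). Joint a b \<in># D}
    \<union> {(a, c) | a b c d. Cross Virtual a b c d \<in># D}
    \<union> {(b, d) | a b c d. Cross Virtual a b c d \<in># D}"

definition arc_of :: "diagram \<Rightarrow> nat \<Rightarrow> nat set"
  where "arc_of D e = equiv_hull (passes D) `` {e}"

definition arcs :: "diagram \<Rightarrow> nat set set"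
  where "arcs D = edges D // equiv_hull (passes D)"

fun graph_vertex :: "'e vertex \<Rightarrow> bool" where
  "graph_vertex (Cross k sw se ne nw) \<longleftrightarrow> k \<noteq> Virtual"
| "graph_vertex (Joint a b) \<longleftrightarrow> False"
| "graph_vertex (Tail a) \<longleftrightarrow> True"
| "graph_vertex (Head a) \<longleftrightarrow> True"

text \<open>An arc meeting no classical crossing and no endpoint is a crossingless closed component.\<close>

definition semiarcs :: "diagram \<Rightarrow> nat set set"
  where "semiarcs D = {s \<in> arcs D. \<exists>v. v \<in># D \<and> graph_vertex v \<and> s \<inter> set_vertex v \<noteq> {}}"

fun crossing_rule ::
  "'x set \<Rightarrow> ('x \<Rightarrow> 'x \<Rightarrow> 'x) \<Rightarrow> ('x \<Rightarrow> 'x \<Rightarrow> 'x) \<Rightarrow> ('e \<Rightarrow> 'x) \<Rightarrow> 'e vertex \<Rightarrow> bool" where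
  "crossing_rule X und ovr c (Cross Positive sw se ne nw) \<longleftrightarrow>
    (\<exists>x\<in>X. \<exists>y\<in>X. c se = x \<and> c nw = und x y \<and> c sw = ovr y x \<and> c ne = y)"
| "crossing_rule X und ovr c (Cross Negative sw se ne nw) \<longleftrightarrow>
    (\<exists>x\<in>X. \<exists>y\<in>X. c sw = und x y \<and> c ne = x \<and> c se = y \<and> c nw = ovr y x)"
| "crossing_rule X und ovr c _ \<longleftrightarrow> True"

definition colorings ::
  "'x set \<Rightarrow> ('x \<Rightarrow> 'x \<Rightarrow> 'x) \<Rightarrow> ('x \<Rightarrow> 'x \<Rightarrow> 'x) \<Rightarrow> diagram \<Rightarrow> (nat set \<Rightarrow> 'x) set"
  where "colorings X und ovr D =
    {f \<in> arcs D \<rightarrow>\<^sub>E X. \<forall>v\<in>#D. crossing_rule X und ovr (\<lambda>e. f (arc_of D e)) v}"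

definition total_fare :: "('x \<Rightarrow> 'a::ab_group_add) \<Rightarrow> diagram \<Rightarrow> (nat set \<Rightarrow> 'x) \<Rightarrow> 'a"
  where "total_fare \<phi> D f = (\<Sum>s\<in>semiarcs D. \<phi> (f s))"

definition fare_multiset ::
  "'x set \<Rightarrow> ('x \<Rightarrow> 'x \<Rightarrow> 'x) \<Rightarrow> ('x \<Rightarrow> 'x \<Rightarrow> 'x) \<Rightarrow> ('x \<Rightarrow> 'a::ab_group_add) \<Rightarrow> diagram \<Rightarrow> 'a multiset"
  where "fare_multiset X und ovr \<phi> D =
    image_mset (total_fare \<phi> D) (mset_set (colorings X und ovr D))"

end

theory Submission imports Defs begin

text \<open>
  Every semiarc leaves exactly one classical crossing or tail, so the total fare is the sum, over
  the crossings and the tail, of \<open>\<phi>\<close> of the outgoing edges. In this form it is local, and it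
  suffices to compare the two sides of each move. The colors of the inner edges of a side are
  determined by those on the boundary, and extend from one side to the other with the same fare.

  For the third move, the twelve edges of a triangle and its counterpart form a cube whose six
  faces are crossings, all written as positive ones. Any three edges at a corner determine the
  whole cube, and the three at a corner have the same sum of \<open>\<phi>\<close> as the three at the opposite
  corner. The oriented third moves replace the three faces at a corner by those at the opposite one.
\<close>

section \<open>Crossings\<close>

text \<open>The arcs that carry the colors are classes of edges, and a move merges or splits such
  classes also outside the disc in which it takes place. On single edges a move changes nothing
  outside its disc. Colorings of arcs and of edges correspond bijectively, and the fares agree
  because a closed cycle of passes has no first edge.

  In the cube, the corner with edges \<open>a3\<close>, \<open>s\<close>, \<open>b1\<close> is a
  source: on each of its three faces the other two edges are values of the operations. The edges
  \<open>a1\<close>, \<open>q\<close>, \<open>b3\<close> at the opposite corner are each reached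
  through two faces, and the three exchange laws say that the two values agree. The third fare axiom
  compares one pair of opposite corners, \<open>p\<close>, \<open>q\<close>, \<open>r\<close> with
  \<open>s\<close>, \<open>t\<close>, \<open>u\<close>. The second says that the edges of a face sum
  to zero, which carries the comparison over to the other three pairs.

  Finiteness of \<open>X\<close> enters the first move: it makes the injective map from x to
  \<open>ovr x x\<close> surjective, so that a strand of any color admits a curl.\<close>

context biquandle
begin

text \<open>A relation between the four colors in a fixed drawing, virtual crossings included, so
  that a move can be treated for all kinds at once. In the classical cases \<open>se\<close> and
  \<open>ne\<close> generate the other two colors.\<close>

fun crossing :: "kind \<Rightarrow> 'x \<Rightarrow> 'x \<Rightarrow> 'x \<Rightarrow> 'x \<Rightarrow> bool" where
  "crossing Positive sw se ne nw \<longleftrightarrow> se \<in> X \<and> ne \<in> X \<and> sw = ovr ne se \<and> nw = und se ne"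
| "crossing Negative sw se ne nw \<longleftrightarrow> ne \<in> X \<and> se \<in> X \<and> nw = ovr se ne \<and> sw = und ne se"
| "crossing Virtual sw se ne nw \<longleftrightarrow> ne \<in> X \<and> se \<in> X \<and> sw = ne \<and> nw = se"

lemma ovr_closed: "x \<in> X \<Longrightarrow> y \<in> X \<Longrightarrow> ovr x y \<in> X"
  using ovr_bij[of y] by (auto simp: bij_betw_def)

lemma und_closed: "x \<in> X \<Longrightarrow> y \<in> X \<Longrightarrow> und x y \<in> X"
  using und_bij[of y] by (auto simp: bij_betw_def)

lemma ovr_cancel: "ovr x y = ovr x' y \<Longrightarrow> x \<in> X \<Longrightarrow> x' \<in> X \<Longrightarrow> y \<in> X \<Longrightarrow> x = x'"
  using ovr_bij[of y] by (auto simp: bij_betw_def inj_on_def)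

lemma und_cancel: "und x y = und x' y \<Longrightarrow> x \<in> X \<Longrightarrow> x' \<in> X \<Longrightarrow> y \<in> X \<Longrightarrow> x = x'"
  using und_bij[of y] by (auto simp: bij_betw_def inj_on_def)

lemma switch_cancel:
  assumes "ovr y x = ovr y' x'" "und x y = und x' y'" "x \<in> X" "y \<in> X" "x' \<in> X" "y' \<in> X"
  shows "x = x' \<and> y = y'"
  using inj_onD[OF bij_betw_imp_inj_on[OF switch_bij], of "(x, y)" "(x', y')"] assms by auto

lemma ovr_surj: "y \<in> X \<Longrightarrow> z \<in> X \<Longrightarrow> \<exists>x\<in>X. ovr x y = z"
  using ovr_bij[of y] unfolding bij_betw_def by (metis imageE)

lemma und_surj: "y \<in> X \<Longrightarrow> z \<in> X \<Longrightarrow> \<exists>x\<in>X. und x y = z"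
  using und_bij[of y] unfolding bij_betw_def by (metis imageE)

lemma switch_surj:
  assumes "z \<in> X" "w \<in> X"
  shows "\<exists>x\<in>X. \<exists>y\<in>X. ovr y x = z \<and> und x y = w"
proof -
  have "(z, w) \<in> (\<lambda>(x, y). (ovr y x, und x y)) ` (X \<times> X)"
    using switch_bij assms by (auto simp: bij_betw_def)
  then show ?thesis by auto
qed

lemma crossing_closed:
  assumes "crossing k sw se ne nw"
  shows "sw \<in> X" "se \<in> X" "ne \<in> X" "nw \<in> X"
  using assms by (cases k; auto simp: ovr_closed und_closed)+

text \<open>Two edges that are neighbors around a crossing determine the other two. From the south
  and the north this is injectivity of the maps \<open>ovr _ y\<close> and \<open>und _ y\<close>,
  from the east it is evaluation of the operations, and from the west it is injectivity of the
  switch map. The lemmas starting with \<open>ex_crossing\<close> are the matching existence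
  statements.\<close>

lemma crossing_south:
  "crossing k sw se ne nw \<Longrightarrow> crossing k sw se ne' nw' \<Longrightarrow> ne = ne' \<and> nw = nw'"
  by (cases k) (auto dest: ovr_cancel und_cancel)

lemma crossing_north:
  "crossing k sw se ne nw \<Longrightarrow> crossing k sw' se' ne nw \<Longrightarrow> sw = sw' \<and> se = se'"
  by (cases k) (auto dest: ovr_cancel und_cancel)

lemma crossing_east:
  "crossing k sw se ne nw \<Longrightarrow> crossing k sw' se ne nw' \<Longrightarrow> sw = sw' \<and> nw = nw'"
  by (cases k) auto

lemma crossing_west:
  "crossing k sw se ne nw \<Longrightarrow> crossing k sw se' ne' nw \<Longrightarrow> se = se' \<and> ne = ne'"
  by (cases k) (auto dest: switch_cancel)

lemma ex_crossing_south: "sw \<in> X \<Longrightarrow> se \<in> X \<Longrightarrow> \<exists>ne nw. crossing k sw se ne nw"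
  by (cases k) (auto dest: ovr_surj[of se sw] und_surj[of se sw])

lemma ex_crossing_north: "ne \<in> X \<Longrightarrow> nw \<in> X \<Longrightarrow> \<exists>sw se. crossing k sw se ne nw"
  by (cases k) (auto dest: ovr_surj[of ne nw] und_surj[of ne nw])

lemma ex_crossing_east: "se \<in> X \<Longrightarrow> ne \<in> X \<Longrightarrow> \<exists>sw nw. crossing k sw se ne nw"
  by (cases k) auto

lemma ex_crossing_west: "sw \<in> X \<Longrightarrow> nw \<in> X \<Longrightarrow> \<exists>se ne. crossing k sw se ne nw"
  using switch_surj[of sw nw] switch_surj[of nw sw] by (cases k) (auto, metis+)

text \<open>By \<open>diag\<close> the two components of the switch map agree at (x, x), so one
  equation between values on the diagonal gives both.\<close>

lemma ovr_diag_cancel: "ovr x x = ovr y y \<Longrightarrow> x \<in> X \<Longrightarrow> y \<in> X \<Longrightarrow> x = y"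
  using switch_cancel[of x x y y] diag[of x] diag[of y] by simp

text \<open>All colors are to be expressed in \<open>a3\<close>, \<open>s\<close> and
  \<open>b1\<close>. This means recovering the unknown \<open>s\<close> from \<open>a2\<close> and
  identifying \<open>b2\<close> as \<open>und s b1\<close>; then \<open>ovr_ovr\<close> and
  \<open>und_und\<close> close the face through \<open>a1\<close> and \<open>b3\<close>.\<close>

lemma cube_from_L:
  assumes "crossing Positive a1 a2 p q" "crossing Positive p a3 b1 r" "crossing Positive q r b2 b3"
  shows "\<exists>s t u. crossing Positive a2 a3 s t \<and> crossing Positive a1 t u b3 \<and> crossing Positive u s b1 b2"
proof -
  have X: "a2 \<in> X" "a3 \<in> X" "b1 \<in> X" "b2 \<in> X"
    using assms by auto
  obtain s where s: "s \<in> X" "ovr s a3 = a2"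
    using ovr_surj X by blast
  \<comment> \<open>Both sides are the color of \<open>q\<close>: the left one read on the face with
    \<open>b2\<close>, the right one on the face with \<open>a2\<close> after
    \<open>und_ovr\<close>.\<close>
  have "ovr b2 (und a3 b1) = ovr (und s b1) (und a3 b1)"
    using assms X s und_ovr[of s b1 a3] by auto
  then have "b2 = und s b1"
    using ovr_cancel X s und_closed by metis
  then have "crossing Positive a2 a3 s (und a3 s)" "crossing Positive (ovr b1 s) s b1 b2"
    "crossing Positive a1 (und a3 s) (ovr b1 s) b3"
    using assms X s ovr_ovr[of b1 a3 s] und_und[of a3 b1 s]
    by (auto simp: ovr_closed und_closed)
  then show ?thesis by blast
qed

text \<open>Here \<open>a3\<close>, \<open>s\<close> and \<open>b1\<close> are all given, so no
  operation has to be inverted.\<close>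

lemma cube_from_R:
  assumes "crossing Positive a2 a3 s t" "crossing Positive a1 t u b3" "crossing Positive u s b1 b2"
  shows "\<exists>p q r. crossing Positive a1 a2 p q \<and> crossing Positive p a3 b1 r \<and> crossing Positive q r b2 b3"
proof -
  have X: "a3 \<in> X" "s \<in> X" "b1 \<in> X"
    using assms by auto
  have "crossing Positive a1 a2 (ovr b1 a3) (und a2 (ovr b1 a3))"
    "crossing Positive (ovr b1 a3) a3 b1 (und a3 b1)"
    "crossing Positive (und a2 (ovr b1 a3)) (und a3 b1) b2 b3"
    using assms X ovr_ovr[of b1 a3 s] und_und[of a3 b1 s] und_ovr[of s b1 a3]
    by (auto simp: ovr_closed und_closed)
  then show ?thesis by blast
qed

text \<open>The first three faces are the left-hand side of \<open>R3_braid\<close> with positive crossings, the last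
  three its right-hand side.\<close>

definition cube :: "'x \<Rightarrow> 'x \<Rightarrow> 'x \<Rightarrow> 'x \<Rightarrow> 'x \<Rightarrow> 'x \<Rightarrow> 'x \<Rightarrow> 'x \<Rightarrow> 'x \<Rightarrow> 'x \<Rightarrow> 'x \<Rightarrow> 'x \<Rightarrow> bool" where
  "cube a1 a2 a3 b1 b2 b3 p q r s t u \<longleftrightarrow>
    crossing Positive a1 a2 p q \<and> crossing Positive p a3 b1 r \<and> crossing Positive q r b2 b3 \<and>
    crossing Positive a2 a3 s t \<and> crossing Positive a1 t u b3 \<and> crossing Positive u s b1 b2"

lemma cube_L:
  assumes "crossing Positive a1 a2 p q" "crossing Positive p a3 b1 r" "crossing Positive q r b2 b3"
  shows "\<exists>s t u. cube a1 a2 a3 b1 b2 b3 p q r s t u"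
  using cube_from_L[OF assms] assms unfolding cube_def by blast

lemma cube_R:
  assumes "crossing Positive a2 a3 s t" "crossing Positive a1 t u b3" "crossing Positive u s b1 b2"
  shows "\<exists>p q r. cube a1 a2 a3 b1 b2 b3 p q r s t u"
  using cube_from_R[OF assms] assms unfolding cube_def by blast

text \<open>The missing face through \<open>p\<close> and \<open>r\<close> can be filled in freely,
  which completes the three faces at the corner \<open>p\<close>, \<open>q\<close>,
  \<open>r\<close>. The resulting cube has its own face through \<open>a1\<close> and
  \<open>b3\<close>, and uniqueness identifies it with the given one. The remaining corners are
  handled likewise, the primed ones starting from \<open>cube_R\<close>.\<close>

lemma cube_1:
  assumes "crossing Positive a1 a2 p q" "crossing Positive q r b2 b3" "crossing Positive a1 t u b3"
  shows "\<exists>b1 a3 s. cube a1 a2 a3 b1 b2 b3 p q r s t u"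
proof -
  obtain a3 b1 where "crossing Positive p a3 b1 r"
    using ex_crossing_west crossing_closed assms by meson
  with assms obtain s t' u' where c: "cube a1 a2 a3 b1 b2 b3 p q r s t' u'"
    using cube_L by blast
  then have "t' = t" "u' = u"
    using crossing_west assms unfolding cube_def by blast+
  with c show ?thesis by blast
qed

lemma cube_2:
  assumes "crossing Positive a1 a2 p q" "crossing Positive p a3 b1 r" "crossing Positive a2 a3 s t"
  shows "\<exists>b2 b3 u. cube a1 a2 a3 b1 b2 b3 p q r s t u"
proof -
  obtain b2 b3 where "crossing Positive q r b2 b3"
    using ex_crossing_south crossing_closed assms by meson
  with assms obtain s' t' u where c: "cube a1 a2 a3 b1 b2 b3 p q r s' t' u"
    using cube_L by blast
  then have "s' = s" "t' = t"
    using crossing_south assms unfolding cube_def by blast+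
  with c show ?thesis by blast
qed

lemma cube_3:
  assumes "crossing Positive p a3 b1 r" "crossing Positive q r b2 b3" "crossing Positive u s b1 b2"
  shows "\<exists>a1 a2 t. cube a1 a2 a3 b1 b2 b3 p q r s t u"
proof -
  obtain a1 a2 where "crossing Positive a1 a2 p q"
    using ex_crossing_north crossing_closed assms by meson
  with assms obtain s' t u' where c: "cube a1 a2 a3 b1 b2 b3 p q r s' t u'"
    using cube_L by blast
  then have "s' = s" "u' = u"
    using crossing_north assms unfolding cube_def by blast+
  with c show ?thesis by blast
qed

lemma cube_1':
  assumes "crossing Positive p a3 b1 r" "crossing Positive a2 a3 s t" "crossing Positive u s b1 b2"
  shows "\<exists>a1 b3 q. cube a1 a2 a3 b1 b2 b3 p q r s t u"
proof -
  obtain a1 b3 where "crossing Positive a1 t u b3"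
    using ex_crossing_east crossing_closed assms by meson
  with assms obtain p' q r' where c: "cube a1 a2 a3 b1 b2 b3 p' q r' s t u"
    using cube_R by blast
  then have "p' = p" "r' = r"
    using crossing_east assms unfolding cube_def by blast+
  with c show ?thesis by blast
qed

lemma cube_2':
  assumes "crossing Positive q r b2 b3" "crossing Positive a1 t u b3" "crossing Positive u s b1 b2"
  shows "\<exists>a2 a3 p. cube a1 a2 a3 b1 b2 b3 p q r s t u"
proof -
  obtain a2 a3 where "crossing Positive a2 a3 s t"
    using ex_crossing_north crossing_closed assms by meson
  with assms obtain p q' r' where c: "cube a1 a2 a3 b1 b2 b3 p q' r' s t u"
    using cube_R by blast
  then have "q' = q" "r' = r"
    using crossing_north assms unfolding cube_def by blast+
  with c show ?thesis by blast
qed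

lemma cube_3':
  assumes "crossing Positive a1 a2 p q" "crossing Positive a2 a3 s t" "crossing Positive a1 t u b3"
  shows "\<exists>b1 b2 r. cube a1 a2 a3 b1 b2 b3 p q r s t u"
proof -
  obtain b1 b2 where "crossing Positive u s b1 b2"
    using ex_crossing_south crossing_closed assms by meson
  with assms obtain p' q' r where c: "cube a1 a2 a3 b1 b2 b3 p' q' r s t u"
    using cube_R by blast
  then have "p' = p" "q' = q"
    using crossing_south assms unfolding cube_def by blast+
  with c show ?thesis by blast
qed

end

section \<open>Fares of curls, bigons and triangles\<close>

locale fare_biquandle = biquandle X und ovr
  for X :: "'x set" and und ovr :: "'x \<Rightarrow> 'x \<Rightarrow> 'x" +
  fixes \<phi> :: "'x \<Rightarrow> 'a::ab_group_add"
  assumes finite_X: "finite X" and fare: "fare1 X und ovr \<phi>"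
begin

text \<open>The contribution of a crossing to the total fare, charged to its two outgoing edges. No
  semiarc starts at a virtual crossing, hence the zero.\<close>

definition out :: "kind \<Rightarrow> 'x \<Rightarrow> 'x \<Rightarrow> 'a" where
  "out k x y = (if k = Virtual then 0 else \<phi> x + \<phi> y)"

text \<open>An injective self-map of a finite set is onto. This supplies the color of the loop in a
  curl.\<close>

lemma ovr_diag_surj: "y \<in> X \<Longrightarrow> \<exists>x\<in>X. ovr x x = y"
proof -
  assume "y \<in> X"
  have "inj_on (\<lambda>x. ovr x x) X" "(\<lambda>x. ovr x x) ` X \<subseteq> X"
    using ovr_diag_cancel ovr_closed by (auto intro!: inj_onI)
  then have "(\<lambda>x. ovr x x) ` X = X"
    using finite_X by (simp add: endo_inj_surj)
  with \<open>y \<in> X\<close> have "y \<in> (\<lambda>x. ovr x x) ` X"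
    by simp
  then show ?thesis by auto
qed

lemma fare_diag: "x \<in> X \<Longrightarrow> \<phi> (und x x) + \<phi> x = 0"
  using fare by (simp add: fare1_def)

lemma fare_pair: "x \<in> X \<Longrightarrow> y \<in> X \<Longrightarrow> \<phi> x + \<phi> y + \<phi> (und x y) + \<phi> (ovr y x) = 0"
  using fare by (simp add: fare1_def)

lemma fare_crossing: "crossing k sw se ne nw \<Longrightarrow> k \<noteq> Virtual \<Longrightarrow> \<phi> sw + \<phi> se + (\<phi> ne + \<phi> nw) = 0"
  using fare_pair[of se ne] fare_pair[of ne se] by (cases k) (auto simp: add_ac)

text \<open>Writing \<open>c\<close> as \<open>ovr z z\<close>, which is also
  \<open>und z z\<close>, shows that (c, c) is the value of the switch map at (z, z). The crossing
  presents the same pair as a value at \<open>x\<close> and \<open>y\<close>, so injectivity forces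
  both to be \<open>z\<close>.\<close>

lemma crossing_diag:
  assumes "crossing k c x y c" "k \<noteq> Virtual"
  shows "x = y \<and> c = ovr x x"
proof -
  have xy: "x \<in> X" "y \<in> X" "c \<in> X"
    using crossing_closed[OF assms(1)] by simp_all
  have c: "ovr y x = c \<and> und x y = c \<or> ovr x y = c \<and> und y x = c"
    using assms by (cases k) auto
  obtain z where z: "z \<in> X" "ovr z z = c" using ovr_diag_surj xy by blast
  with diag have "und z z = c" by simp
  with c z xy show ?thesis
    using switch_cancel[of y x z z] switch_cancel[of x y z z] by auto
qed

lemma curl_right:
  "crossing k a c c b \<Longrightarrow> a = b \<and> b \<in> X \<and> out k c b = 0"
  using fare_diag[of c] by (cases k) (auto simp: diag out_def add.commute ovr_closed)

lemma ex_curl_right: "a \<in> X \<Longrightarrow> \<exists>c. crossing k a c c a"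
  using ovr_diag_surj[of a] diag by (cases k) auto

lemma curl_left:
  "crossing k c a b c \<Longrightarrow> a = b \<and> b \<in> X \<and> out k b c = 0"
  using crossing_diag[of k c a b] fare_diag[of a]
  by (cases k) (auto simp: diag out_def add.commute)

lemma ex_curl_left: "a \<in> X \<Longrightarrow> \<exists>c. crossing k c a a c"
  using diag ovr_closed by (cases k) auto

lemma opposite_Virtual [simp]: "opposite k = Virtual \<longleftrightarrow> k = Virtual"
  by (cases k) auto

text \<open>The edges of each face sum to zero, so one equation between opposite corners implies
  those for the other three pairs.\<close>

lemma fare_cube:
  assumes "cube a1 a2 a3 b1 b2 b3 p q r s t u"
  shows "\<phi> p + \<phi> q + \<phi> r = \<phi> s + \<phi> t + \<phi> u"
    "\<phi> q + \<phi> a1 + \<phi> b3 = \<phi> s + \<phi> b1 + \<phi> a3"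
    "\<phi> p + \<phi> a2 + \<phi> a3 = \<phi> u + \<phi> b2 + \<phi> b3"
    "\<phi> r + \<phi> b1 + \<phi> b2 = \<phi> t + \<phi> a1 + \<phi> a2"
proof -
  have faces: "\<phi> a1 + \<phi> a2 + (\<phi> p + \<phi> q) = 0" "\<phi> p + \<phi> a3 + (\<phi> b1 + \<phi> r) = 0"
    "\<phi> q + \<phi> r + (\<phi> b2 + \<phi> b3) = 0" "\<phi> a2 + \<phi> a3 + (\<phi> s + \<phi> t) = 0"
    "\<phi> u + \<phi> s + (\<phi> b1 + \<phi> b2) = 0"
    using assms fare_crossing[of Positive] unfolding cube_def by blast+
  have "a3 \<in> X" "s \<in> X" "b1 \<in> X" and eqs: "t = und a3 s" "u = ovr b1 s" "p = ovr b1 a3"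
    "r = und a3 b1" "q = und (ovr s a3) (ovr b1 a3)"
    using assms by (simp_all add: cube_def)
  \<comment> \<open>The third fare axiom with \<open>a3\<close>, \<open>s\<close>, \<open>b1\<close>
    for x, y, z.\<close>
  then have "\<phi> s + \<phi> t + \<phi> u = \<phi> p + \<phi> r + \<phi> q"
    using fare unfolding eqs fare1_def by blast
  then show top: "\<phi> p + \<phi> q + \<phi> r = \<phi> s + \<phi> t + \<phi> u"
    by (simp add: add_ac)
  \<comment> \<open>Four faces are solved for one edge each, the corner equation for
    \<open>u\<close>, and the last face for \<open>s\<close>. In the remaining unknowns the three
    claims become identities in an abelian group.\<close>
  have a1: "\<phi> a1 = - (\<phi> a2 + (\<phi> p + \<phi> q))" and b1: "\<phi> b1 = - (\<phi> p + (\<phi> a3 + \<phi> r))"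
    and b2: "\<phi> b2 = - (\<phi> q + (\<phi> r + \<phi> b3))" and t: "\<phi> t = - (\<phi> a2 + (\<phi> a3 + \<phi> s))"
    using faces by (simp_all add: eq_neg_iff_add_eq_0 add_ac del: minus_add_distrib)
  have u: "\<phi> u = \<phi> p + \<phi> q + \<phi> r + \<phi> a2 + \<phi> a3"
    using top t by (simp add: algebra_simps)
  have s: "\<phi> s = \<phi> r + \<phi> b3 - \<phi> a2"
    using faces(5) unfolding u b1 b2 by (simp add: algebra_simps)
  show "\<phi> q + \<phi> a1 + \<phi> b3 = \<phi> s + \<phi> b1 + \<phi> a3"
    unfolding a1 s b1 by (simp add: algebra_simps)
  show "\<phi> p + \<phi> a2 + \<phi> a3 = \<phi> u + \<phi> b2 + \<phi> b3"
    unfolding u b2 by (simp add: algebra_simps)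
  show "\<phi> r + \<phi> b1 + \<phi> b2 = \<phi> t + \<phi> a1 + \<phi> a2"
    unfolding a1 t b1 b2 s by (simp add: algebra_simps)
qed

text \<open>Turning the drawing upside down by a reflection exchanges incoming and outgoing edges
  and reverses the sign. Hence the two crossings of a second move satisfy one and the same
  relation.\<close>

lemma crossing_opposite: "crossing (opposite k) sw se ne nw \<longleftrightarrow> crossing k nw ne se sw"
  by (cases k) auto

lemma out_in: "crossing k sw se ne nw \<Longrightarrow> out k sw se + out k ne nw = 0"
  using fare_crossing by (simp add: out_def)

text \<open>In all three bigons the two crossings share the inner edges, which by
  \<open>crossing_opposite\<close> determine the outer colors of both alike. The edges leaving the
  second crossing therefore carry the colors of those entering the first, and the fares cancel by
  \<open>out_in\<close>.\<close>

lemma bigon_parallel: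
  assumes "crossing k a c x y" "crossing (opposite k) y x d b"
  shows "a = b \<and> b \<in> X \<and> c = d \<and> d \<in> X \<and> out k x y + out (opposite k) d b = 0"
proof -
  have "crossing k b d x y" using assms(2) by (simp add: crossing_opposite)
  with crossing_north assms(1) have "b = a" "d = c" by blast+
  with crossing_closed[OF assms(1)] out_in[OF assms(1)] show ?thesis
    by (cases "k = Virtual") (simp_all add: out_def add_ac)
qed

lemma bigon_antiparallel_left:
  assumes "crossing k y a d x" "crossing (opposite k) x c b y"
  shows "a = b \<and> b \<in> X \<and> c = d \<and> d \<in> X \<and> out k d x + out (opposite k) b y = 0"
proof -
  have "crossing k y b c x" using assms(2) by (simp add: crossing_opposite)
  with crossing_west assms(1) have "b = a" "d = c" by blast+
  with crossing_closed[OF assms(1)] out_in[OF assms(1)] show ?thesis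
    by (cases "k = Virtual") (simp_all add: out_def add_ac)
qed

lemma bigon_antiparallel_right:
  assumes "crossing k a y x d" "crossing (opposite k) c x y b"
  shows "a = b \<and> b \<in> X \<and> c = d \<and> d \<in> X \<and> out k x d + out (opposite k) y b = 0"
proof -
  have "crossing k b y x c" using assms(2) by (simp add: crossing_opposite)
  with crossing_east assms(1) have "b = a" "d = c" by blast+
  with crossing_closed[OF assms(1)] out_in[OF assms(1)] show ?thesis
    by (cases "k = Virtual") (simp_all add: out_def add_ac)
qed

lemma Negative_iff: "crossing Negative sw se ne nw \<longleftrightarrow> crossing Positive nw ne se sw"
  by auto

lemma hexagon_L:
  assumes "crossing Positive a1 a2 p q" "crossing Positive p a3 b1 r" "crossing Positive q r b2 b3"
  shows "\<exists>s t u. crossing Positive a2 a3 s t \<and> crossing Positive a1 t u b3 \<and> crossing Positive u s b1 b2 \<and>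
    \<phi> p + \<phi> q + \<phi> r = \<phi> s + \<phi> t + \<phi> u"
  by (insert cube_L[OF assms], elim exE, frule fare_cube(1), unfold cube_def) blast

lemma hexagon_R:
  assumes "crossing Positive a2 a3 s t" "crossing Positive a1 t u b3" "crossing Positive u s b1 b2"
  shows "\<exists>p q r. crossing Positive a1 a2 p q \<and> crossing Positive p a3 b1 r \<and> crossing Positive q r b2 b3 \<and>
    \<phi> p + \<phi> q + \<phi> r = \<phi> s + \<phi> t + \<phi> u"
  by (insert cube_R[OF assms], elim exE, frule fare_cube(1), unfold cube_def) blast

lemma hexagon_1:
  assumes "crossing Positive a1 a2 p q" "crossing Positive q r b2 b3" "crossing Positive a1 t u b3"
  shows "\<exists>b1 a3 s. crossing Positive p a3 b1 r \<and> crossing Positive a2 a3 s t \<and> crossing Positive u s b1 b2 \<and>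
    \<phi> q + \<phi> a1 + \<phi> b3 = \<phi> s + \<phi> b1 + \<phi> a3"
  by (insert cube_1[OF assms], elim exE, frule fare_cube(2), unfold cube_def) blast

lemma hexagon_1':
  assumes "crossing Positive p a3 b1 r" "crossing Positive a2 a3 s t" "crossing Positive u s b1 b2"
  shows "\<exists>a1 b3 q. crossing Positive a1 a2 p q \<and> crossing Positive q r b2 b3 \<and> crossing Positive a1 t u b3 \<and>
    \<phi> q + \<phi> a1 + \<phi> b3 = \<phi> s + \<phi> b1 + \<phi> a3"
  by (insert cube_1'[OF assms], elim exE, frule fare_cube(2), unfold cube_def) blast

lemma hexagon_2:
  assumes "crossing Positive a1 a2 p q" "crossing Positive p a3 b1 r" "crossing Positive a2 a3 s t"
  shows "\<exists>b2 b3 u. crossing Positive q r b2 b3 \<and> crossing Positive a1 t u b3 \<and> crossing Positive u s b1 b2 \<and>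
    \<phi> p + \<phi> a2 + \<phi> a3 = \<phi> u + \<phi> b2 + \<phi> b3"
  by (insert cube_2[OF assms], elim exE, frule fare_cube(3), unfold cube_def) blast

lemma hexagon_2':
  assumes "crossing Positive q r b2 b3" "crossing Positive a1 t u b3" "crossing Positive u s b1 b2"
  shows "\<exists>a2 a3 p. crossing Positive a1 a2 p q \<and> crossing Positive p a3 b1 r \<and> crossing Positive a2 a3 s t \<and>
    \<phi> p + \<phi> a2 + \<phi> a3 = \<phi> u + \<phi> b2 + \<phi> b3"
  by (insert cube_2'[OF assms], elim exE, frule fare_cube(3), unfold cube_def) blast

lemma hexagon_3:
  assumes "crossing Positive p a3 b1 r" "crossing Positive q r b2 b3" "crossing Positive u s b1 b2"
  shows "\<exists>a1 a2 t. crossing Positive a1 a2 p q \<and> crossing Positive a2 a3 s t \<and> crossing Positive a1 t u b3 \<and>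
    \<phi> r + \<phi> b1 + \<phi> b2 = \<phi> t + \<phi> a1 + \<phi> a2"
  by (insert cube_3[OF assms], elim exE, frule fare_cube(4), unfold cube_def) blast

lemma hexagon_3':
  assumes "crossing Positive a1 a2 p q" "crossing Positive a2 a3 s t" "crossing Positive a1 t u b3"
  shows "\<exists>b1 b2 r. crossing Positive p a3 b1 r \<and> crossing Positive q r b2 b3 \<and> crossing Positive u s b1 b2 \<and>
    \<phi> r + \<phi> b1 + \<phi> b2 = \<phi> t + \<phi> a1 + \<phi> a2"
  by (insert cube_3'[OF assms], elim exE, frule fare_cube(4), unfold cube_def) blast

text \<open>One rule for each of the eight corners. They differ in the positions that the shared
  edges take at the three crossings, so the given triple selects the rule.\<close>

lemmas hexagons =
  hexagon_L hexagon_R hexagon_1 hexagon_1' hexagon_2 hexagon_2' hexagon_3 hexagon_3'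

lemma triangle_kinds_cases [consumes 1, case_names Virtual Classical]:
  assumes "triangle_kinds k12 k23 k31"
  obtains "k12 = Virtual \<and> k23 = Virtual \<or> k23 = Virtual \<and> k31 = Virtual \<or> k31 = Virtual \<and> k12 = Virtual"
  | "k12 = Positive \<and> k23 = Positive \<and> k31 = Negative \<or>
     k12 = Positive \<and> k23 = Negative \<and> k31 = Positive \<or>
     k12 = Negative \<and> k23 = Positive \<and> k31 = Positive \<or>
     k12 = Negative \<and> k23 = Negative \<and> k31 = Positive \<or>
     k12 = Negative \<and> k23 = Positive \<and> k31 = Negative \<or>
     k12 = Positive \<and> k23 = Negative \<and> k31 = Negative"
  using assms by (cases k12; cases k23; cases k31) (auto simp: triangle_kinds_def)

lemma opposite_eq: "opposite k = Positive \<longleftrightarrow> k = Negative" "opposite k = Negative \<longleftrightarrow> k = Positive"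
  by (cases k; simp)+

text \<open>A strand that is virtual at both of its crossings transmits its color, and the third
  crossing keeps its four colors. In the classical case the crossing of strands 1 and 3 has its
  inner edges to the west for either sign, while a change of sign at one of the others swaps north
  and south. So \<open>k12\<close> and \<open>k23\<close> decide on the corner:
  \<open>hexagon_L\<close> if they are equal, \<open>hexagon_2'\<close> for positive and negative,
  \<open>hexagon_3'\<close> for negative and positive. The converse \<open>braid_left\<close> uses
  the opposite corners.\<close>

lemma braid_right:
  assumes "triangle_kinds k12 k23 (opposite k13)"
    and "crossing k12 a1 a2 p q" "crossing k13 p a3 b1 r" "crossing k23 q r b2 b3"
  shows "\<exists>s t u. crossing k23 a2 a3 s t \<and> crossing k13 a1 t u b3 \<and> crossing k12 u s b1 b2 \<and>
    out k23 s t + out k13 u b3 + out k12 b1 b2 =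
    out k12 p q + out k13 b1 r + out k23 b2 b3"
  using assms(1)
proof (cases rule: triangle_kinds_cases)
  case Virtual
  then show ?thesis
    using assms(2-) crossing_closed[OF assms(2)] crossing_closed[OF assms(3)] crossing_closed[OF assms(4)]
    by (elim disjE conjE; simp add: out_def)
next
  case Classical
  then show ?thesis
    using assms(2-) by - (elim disjE conjE; (simp only: Negative_iff opposite_eq, drule (2) hexagons,
        elim exE conjE, intro exI conjI, assumption+, simp add: out_def add_ac))
qed

lemma braid_left:
  assumes "triangle_kinds k12 k23 (opposite k13)"
    and "crossing k23 a2 a3 s t" "crossing k13 a1 t u b3" "crossing k12 u s b1 b2"
  shows "\<exists>p q r. crossing k12 a1 a2 p q \<and> crossing k13 p a3 b1 r \<and> crossing k23 q r b2 b3 \<and>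
    out k12 p q + out k13 b1 r + out k23 b2 b3 =
    out k23 s t + out k13 u b3 + out k12 b1 b2"
  using assms(1)
proof (cases rule: triangle_kinds_cases)
  case Virtual
  then show ?thesis
    using assms(2-) crossing_closed[OF assms(2)] crossing_closed[OF assms(3)] crossing_closed[OF assms(4)]
    by (elim disjE conjE; simp add: out_def)
next
  case Classical
  then show ?thesis
    using assms(2-) by - (elim disjE conjE; (simp only: Negative_iff opposite_eq, drule (2) hexagons,
        elim exE conjE, intro exI conjI, assumption+, simp add: out_def add_ac))
qed

text \<open>On the left-hand side all inner edges lie to the west of their crossings, whatever the
  signs, and only the corner of \<open>hexagon_1\<close> looks like this. On the other side they lie
  to the east, as in \<open>hexagon_1'\<close>.\<close>

lemma alternating_right:
  assumes "triangle_kinds k12 k23 k31"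
    and "crossing k12 p a2 b1 q" "crossing k23 q a3 b2 r" "crossing k31 r a1 b3 p"
  shows "\<exists>s t u. crossing k12 a1 t s b2 \<and> crossing k23 a2 u t b3 \<and> crossing k31 a3 s u b1 \<and>
    out k12 s b2 + out k23 t b3 + out k31 u b1 =
    out k12 b1 q + out k23 b2 r + out k31 b3 p"
  using assms(1)
proof (cases rule: triangle_kinds_cases)
  case Virtual
  then show ?thesis
    using assms(2-) crossing_closed[OF assms(2)] crossing_closed[OF assms(3)] crossing_closed[OF assms(4)]
    by (elim disjE conjE; simp add: out_def)
next
  case Classical
  then show ?thesis
    using assms(2-) by - (elim disjE conjE; (simp only: Negative_iff opposite_eq, drule (2) hexagons,
        elim exE conjE, intro exI conjI, assumption+, simp add: out_def add_ac))
qed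

lemma alternating_left:
  assumes "triangle_kinds k12 k23 k31"
    and "crossing k12 a1 t s b2" "crossing k23 a2 u t b3" "crossing k31 a3 s u b1"
  shows "\<exists>p q r. crossing k12 p a2 b1 q \<and> crossing k23 q a3 b2 r \<and> crossing k31 r a1 b3 p \<and>
    out k12 b1 q + out k23 b2 r + out k31 b3 p =
    out k12 s b2 + out k23 t b3 + out k31 u b1"
  using assms(1)
proof (cases rule: triangle_kinds_cases)
  case Virtual
  then show ?thesis
    using assms(2-) crossing_closed[OF assms(2)] crossing_closed[OF assms(3)] crossing_closed[OF assms(4)]
    by (elim disjE conjE; simp add: out_def)
next
  case Classical
  then show ?thesis
    using assms(2-) by - (elim disjE conjE; (simp only: Negative_iff opposite_eq, drule (2) hexagons,
        elim exE conjE, intro exI conjI, assumption+, simp add: out_def add_ac))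
qed

end

section \<open>Semiarcs and edges\<close>

definition all_edges :: "diagram \<Rightarrow> nat set" where
  "all_edges D = (\<Union>v\<in>set_mset D. set_vertex v)"

lemma finite_all_edges [simp]: "finite (all_edges D)"
proof -
  have "finite (set_vertex v)" for v :: "nat vertex"
    by (cases v) auto
  then show ?thesis by (simp add: all_edges_def)
qed

lemma set_vertex_rotation: "e \<in> set_vertex v \<longleftrightarrow> Start e \<in> set (rotation v) \<or> End e \<in> set (rotation v)"
  by (cases v) auto

lemma darts_iff: "d \<in> darts D \<longleftrightarrow> (\<exists>v. v \<in># D \<and> d \<in> set (rotation v))"
  by (auto simp: darts_def dart_mset_def)

lemma edges_eq:
  assumes "well_formed D"
  shows "edges D = all_edges D"
proof -
  have "Start e \<in> darts D \<longleftrightarrow> End e \<in> darts D" for e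
    using assms unfolding well_formed_def darts_def by (metis count_eq_zero_iff)
  moreover have "e \<in> all_edges D \<longleftrightarrow> Start e \<in> darts D \<or> End e \<in> darts D" for e
    by (auto simp: all_edges_def set_vertex_rotation darts_iff)
  ultimately show ?thesis
    by (auto simp: edges_def)
qed

lemma count_dart_mset_le: "well_formed D \<Longrightarrow> count (dart_mset D) d \<le> 1"
  unfolding well_formed_def by (cases d) metis+

lemma dart_mset_add_mset: "dart_mset (add_mset v D) = mset (rotation v) + dart_mset D"
  by (simp add: dart_mset_def)

lemma distinct_rotation:
  assumes "well_formed D" "v \<in># D"
  shows "distinct (rotation v)"
proof -
  obtain D' where "D = add_mset v D'"
    using assms(2) by (metis mset_add)
  then have "count (mset (rotation v)) d \<le> 1" for d
    using count_dart_mset_le[OF assms(1), of d] by (simp add: dart_mset_add_mset)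
  then show ?thesis
    unfolding distinct_count_atmost_1 by (metis One_nat_def count_greater_zero_iff le_antisym less_eq_Suc_le not_in_iff set_mset_mset)
qed

lemma dart_vertex_unique:
  assumes "well_formed D" "v \<in># D" "w \<in># D" "d \<in> set (rotation v)" "d \<in> set (rotation w)"
  shows "v = w"
proof (rule ccontr)
  assume "v \<noteq> w"
  obtain D' where D': "D = add_mset v D'"
    using assms(2) by (metis mset_add)
  with \<open>v \<noteq> w\<close> assms(3) have "w \<in># D'" by simp
  with assms(5) have "d \<in># dart_mset D'" by (auto simp: dart_mset_def)
  then have "0 < count (dart_mset D') d" by simp
  moreover have "0 < count (mset (rotation v)) d"
    using assms(4) by (metis count_greater_zero_iff set_mset_mset)
  moreover have "count (mset (rotation v)) d + count (dart_mset D') d \<le> 1"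
    using count_dart_mset_le[OF assms(1), of d] by (simp add: D' dart_mset_add_mset)
  ultimately show False by linarith
qed

section \<open>Passes form directed paths and cycles\<close>

lemma passes_iff:
  "(a, b) \<in> passes D \<longleftrightarrow> Joint a b \<in># D \<or> (\<exists>x y. Cross Virtual a x b y \<in># D \<or> Cross Virtual x a y b \<in># D)"
  by (auto simp: passes_def)

lemma passes_vertex:
  assumes "(a, b) \<in> passes D"
  shows "\<exists>v. v \<in># D \<and> \<not> graph_vertex v \<and> End a \<in> set (rotation v) \<and> Start b \<in> set (rotation v)"
  using assms unfolding passes_iff by (elim disjE exE) force+

lemma Range_passes: "b \<in> Range (passes D) \<longleftrightarrow> (\<exists>v. v \<in># D \<and> \<not> graph_vertex v \<and> Start b \<in> set (rotation v))"
proof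
  assume "\<exists>v. v \<in># D \<and> \<not> graph_vertex v \<and> Start b \<in> set (rotation v)"
  then obtain v where "v \<in># D" "\<not> graph_vertex v" "Start b \<in> set (rotation v)" by blast
  then show "b \<in> Range (passes D)"
    by (cases v) (auto simp: Range_iff passes_iff)
qed (use passes_vertex in blast)

lemma Domain_passes: "a \<in> Domain (passes D) \<longleftrightarrow> (\<exists>v. v \<in># D \<and> \<not> graph_vertex v \<and> End a \<in> set (rotation v))"
proof
  assume "\<exists>v. v \<in># D \<and> \<not> graph_vertex v \<and> End a \<in> set (rotation v)"
  then obtain v where "v \<in># D" "\<not> graph_vertex v" "End a \<in> set (rotation v)" by blast
  then show "a \<in> Domain (passes D)"
    by (cases v) (auto simp: Domain_iff passes_iff)
qed (use passes_vertex in blast)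

fun strand_passes :: "'e vertex \<Rightarrow> ('e \<times> 'e) set" where
  "strand_passes (Joint a b) = {(a, b)}"
| "strand_passes (Cross k sw se ne nw) = (if k = Virtual then {(sw, ne), (se, nw)} else {})"
| "strand_passes _ = {}"

lemma passes_eq: "(a, b) \<in> passes D \<longleftrightarrow> (\<exists>v. v \<in># D \<and> (a, b) \<in> strand_passes v)"
proof
  assume "\<exists>v. v \<in># D \<and> (a, b) \<in> strand_passes v"
  then obtain v where "v \<in># D" "(a, b) \<in> strand_passes v" by blast
  then show "(a, b) \<in> passes D"
    by (cases v) (auto simp: passes_iff split: if_splits)
qed (auto simp: passes_iff; force)

lemma strand_passes_darts: "(a, b) \<in> strand_passes v \<Longrightarrow> End a \<in> set (rotation v) \<and> Start b \<in> set (rotation v)"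
  by (cases v) (auto split: if_splits)

text \<open>An edge ends at one vertex and starts at one vertex, and there it occurs once. So it is
  continued in at most one way in either direction.\<close>

lemma single_valued_passes:
  assumes "well_formed D"
  shows "single_valued (passes D)" "single_valued ((passes D)\<inverse>)"
proof -
  have "b = b'" if "(a, b) \<in> passes D" "(a, b') \<in> passes D" for a b b'
  proof -
    from that obtain v w where vw: "v \<in># D" "w \<in># D" "(a, b) \<in> strand_passes v" "(a, b') \<in> strand_passes w"
      unfolding passes_eq by blast
    with dart_vertex_unique[OF assms, of v w "End a"] have "w = v"
      by (auto dest: strand_passes_darts)
    with vw distinct_rotation[OF assms vw(1)] show ?thesis
      by (cases v) (auto split: if_splits)
  qed
  then show "single_valued (passes D)" by (auto simp: single_valued_def)
  have "b = b'" if "(b, a) \<in> passes D" "(b', a) \<in> passes D" for a b b'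
  proof -
    from that obtain v w where vw: "v \<in># D" "w \<in># D" "(b, a) \<in> strand_passes v" "(b', a) \<in> strand_passes w"
      unfolding passes_eq by blast
    with dart_vertex_unique[OF assms, of v w "Start a"] have "w = v"
      by (auto dest: strand_passes_darts)
    with vw distinct_rotation[OF assms vw(1)] show ?thesis
      by (cases v) (auto split: if_splits)
  qed
  then show "single_valued ((passes D)\<inverse>)" by (auto simp: single_valued_def)
qed

lemma passes_edges: "well_formed D \<Longrightarrow> (a, b) \<in> passes D \<Longrightarrow> a \<in> edges D \<and> b \<in> edges D"
  using passes_vertex[of a b D] by (auto simp: edges_eq all_edges_def set_vertex_rotation)

lemma equiv_equiv_hull: "equiv UNIV (equiv_hull r)"
proof -
  have "sym (r \<union> r\<inverse>)" by (auto intro: symI)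
  then show ?thesis
    by (auto simp: equiv_def equiv_hull_def refl_on_def sym_rtrancl trans_rtrancl)
qed

text \<open>In a zigzag, a change of direction can only retrace the previous step.\<close>

lemma equiv_hull_directed:
  assumes "single_valued r" "single_valued (r\<inverse>)" "(x, y) \<in> equiv_hull r"
  shows "(x, y) \<in> r\<^sup>* \<or> (y, x) \<in> r\<^sup>*"
  using assms(3) unfolding equiv_hull_def
proof (induction rule: rtrancl_induct)
  case (step y z)
  have "(x, z) \<in> r\<^sup>* \<or> (z, x) \<in> r\<^sup>*" if "(y, z) \<in> r" "(y, x) \<in> r\<^sup>*"
    using that(2)
  proof (cases rule: converse_rtranclE)
    case (step w)
    with that assms(1) have "w = z" by (auto dest: single_valuedD)
    with step show ?thesis by blast
  qed (use that in blast)
  moreover have "(x, z) \<in> r\<^sup>* \<or> (z, x) \<in> r\<^sup>*" if "(z, y) \<in> r" "(x, y) \<in> r\<^sup>*"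
    using that(2)
  proof (cases rule: rtranclE)
    case (step w)
    with that assms(2) have "w = z" by (auto dest: single_valuedD)
    with step show ?thesis by blast
  qed (use that in blast)
  ultimately show ?case
    using step.hyps(2) step.IH by (auto intro: rtrancl_into_rtrancl converse_rtrancl_into_rtrancl)
qed simp

lemma ex_initial:
  assumes "finite r" "single_valued r" "e \<notin> Domain r"
  shows "\<exists>e'. (e', e) \<in> r\<^sup>* \<and> e' \<notin> Range r"
proof (rule ccontr)
  assume neg: "\<not> ?thesis"
  define A where "A = {x. (x, e) \<in> r\<^sup>*}"
  have "A \<subseteq> insert e (Domain r)"
    by (auto simp: A_def elim: converse_rtranclE)
  then have "finite A"
    using assms(1) by (auto intro: finite_subset simp: finite_Domain)
  \<comment> \<open>If every ancestor of \<open>e\<close> had a predecessor, choosing predecessors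
    would be an injection of the finite set of ancestors into itself, hence onto. Then
    \<open>e\<close> would be a predecessor as well, although it has no successor.\<close>
  have "\<forall>x\<in>A. \<exists>y. (y, x) \<in> r"
    using neg by (auto simp: A_def)
  then obtain p where p: "\<And>x. x \<in> A \<Longrightarrow> (p x, x) \<in> r" by metis
  then have "p ` A \<subseteq> A"
    by (auto simp: A_def intro: converse_rtrancl_into_rtrancl)
  moreover have "inj_on p A"
    using p assms(2) by (metis inj_onI single_valuedD)
  ultimately have "p ` A = A"
    using \<open>finite A\<close> by (simp add: endo_inj_surj)
  moreover have "e \<in> A" by (simp add: A_def)
  ultimately show False
    using p assms(3) by (metis DomainI imageE)
qed

lemma arc_of_eq: "arc_of D e = arc_of D e' \<longleftrightarrow> (e, e') \<in> equiv_hull (passes D)"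
  unfolding arc_of_def by (rule eq_equiv_class_iff[OF equiv_equiv_hull UNIV_I UNIV_I])

lemma mem_arc_of: "e \<in> arc_of D e"
  using equiv_class_self[OF equiv_equiv_hull UNIV_I] by (simp add: arc_of_def)

lemma arcs_eq: "arcs D = arc_of D ` edges D"
  by (auto simp: arcs_def arc_of_def quotient_def)

lemma arc_of_mem: "e' \<in> arc_of D e \<Longrightarrow> arc_of D e' = arc_of D e"
  by (metis Image_singleton_iff arc_of_def arc_of_eq)

definition initial_edges :: "diagram \<Rightarrow> nat set" where
  "initial_edges D = {e. \<exists>v. v \<in># D \<and> graph_vertex v \<and> Start e \<in> set (rotation v)}"

lemma initial_edges_eq:
  assumes "well_formed D"
  shows "initial_edges D = edges D - Range (passes D)"
proof (rule set_eqI)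
  fix e
  have "graph_vertex w" if "v \<in># D" "graph_vertex v" "Start e \<in> set (rotation v)"
      "w \<in># D" "Start e \<in> set (rotation w)" for v w
    using dart_vertex_unique[OF assms that(1,4,3,5)] that(2) by simp
  then show "e \<in> initial_edges D \<longleftrightarrow> e \<in> edges D - Range (passes D)"
    unfolding initial_edges_def edges_def darts_iff Diff_iff Range_passes mem_Collect_eq by meson
qed

lemma finite_passes:
  assumes "well_formed D"
  shows "finite (passes D)"
proof (rule finite_subset)
  show "passes D \<subseteq> edges D \<times> edges D"
    using passes_edges[OF assms] by auto
qed (simp add: edges_eq assms)

lemma inj_on_arc_of:
  assumes "well_formed D"
  shows "inj_on (arc_of D) (initial_edges D)"
proof (rule inj_onI)
  fix e e' assume e: "e \<in> initial_edges D" "e' \<in> initial_edges D" "arc_of D e = arc_of D e'"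
  then have "(e, e') \<in> (passes D)\<^sup>* \<or> (e', e) \<in> (passes D)\<^sup>*"
    by (intro equiv_hull_directed single_valued_passes assms) (simp add: arc_of_eq)
  with e(1,2) show "e = e'"
    unfolding initial_edges_eq[OF assms] by (auto elim: rtranclE)
qed

text \<open>A class of edges that touches a classical crossing or an endpoint is a path of passes,
  represented by its first edge. The cycles are the crossingless closed components; they have no
  first edge and drop out on both sides.\<close>

lemma semiarcs_eq:
  assumes "well_formed D"
  shows "semiarcs D = arc_of D ` initial_edges D"
proof (intro equalityI subsetI)
  fix s assume "s \<in> semiarcs D"
  then obtain e v where v: "s \<in> arcs D" "v \<in># D" "graph_vertex v" "e \<in> s" "e \<in> set_vertex v"
    by (auto simp: semiarcs_def)
  then have s: "s = arc_of D e"
    by (auto simp: arcs_eq arc_of_mem)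
  show "s \<in> arc_of D ` initial_edges D"
  proof (cases "Start e \<in> set (rotation v)")
    case True
    with v s show ?thesis by (auto simp: initial_edges_def)
  next
    case False
    with v have "End e \<in> set (rotation v)"
      by (simp add: set_vertex_rotation)
    \<comment> \<open>Here \<open>e\<close> is the last edge of its path, and the first one is found
      by walking back.\<close>
    with v dart_vertex_unique[OF assms] have "e \<notin> Domain (passes D)"
      unfolding Domain_passes by blast
    from ex_initial[OF finite_passes[OF assms] single_valued_passes(1)[OF assms] this]
    obtain e' where e': "(e', e) \<in> (passes D)\<^sup>*" "e' \<notin> Range (passes D)" by blast
    have "e \<in> edges D"
      using v assms by (auto simp: edges_eq all_edges_def)
    with e'(1) passes_edges[OF assms] have "e' \<in> edges D"
      by (auto elim: converse_rtranclE)
    with e'(2) have "e' \<in> initial_edges D"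
      by (simp add: initial_edges_eq[OF assms])
    moreover have "(e', e) \<in> equiv_hull (passes D)"
      using e'(1) rtrancl_mono[of "passes D"] unfolding equiv_hull_def by blast
    ultimately show ?thesis
      using s by (metis arc_of_eq imageI)
  qed
next
  fix s assume "s \<in> arc_of D ` initial_edges D"
  then obtain e v where v: "s = arc_of D e" "v \<in># D" "graph_vertex v" "Start e \<in> set (rotation v)"
    by (auto simp: initial_edges_def)
  then have "e \<in> s \<inter> set_vertex v"
    by (simp add: mem_arc_of set_vertex_rotation)
  moreover have "e \<in> edges D"
    using v by (auto simp: edges_def darts_iff)
  ultimately show "s \<in> semiarcs D"
    using v by (auto simp: semiarcs_def arcs_eq)
qed

section \<open>The total fare as a sum over vertices\<close>

fun outgoing :: "'e vertex \<Rightarrow> 'e list" where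
  "outgoing (Cross k sw se ne nw) = (if k = Virtual then [] else [ne, nw])"
| "outgoing (Joint a b) = []"
| "outgoing (Tail a) = [a]"
| "outgoing (Head a) = []"

lemma set_outgoing: "e \<in> set (outgoing v) \<longleftrightarrow> graph_vertex v \<and> Start e \<in> set (rotation v)"
  by (cases v) auto

lemma mset_initial_edges:
  assumes "well_formed D"
  shows "mset_set (initial_edges D) = (\<Sum>v\<in>#D. mset (outgoing v))"
proof -
  have "count (mset (outgoing v)) e \<le> count (mset (rotation v)) (Start e)" for v and e :: nat
    by (cases v) auto
  then have "count (\<Sum>v\<in>#D. mset (outgoing v)) e \<le> count (dart_mset D) (Start e)" for e
    unfolding dart_mset_def by (induction D) (auto intro: add_mono)
  then have "count (\<Sum>v\<in>#D. mset (outgoing v)) e \<le> 1" for e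
    using count_dart_mset_le[OF assms] order_trans by metis
  moreover have "set_mset (\<Sum>v\<in>#D. mset (outgoing v)) = initial_edges D"
    by (auto simp: initial_edges_def set_outgoing)
  ultimately show ?thesis
    by (intro multiset_eqI) (metis One_nat_def count_greater_zero_iff count_mset_set(1) count_mset_set(3)
        finite_set_mset le_antisym less_eq_Suc_le not_in_iff)
qed

lemma total_fare_eq:
  fixes \<phi> :: "'x \<Rightarrow> 'b::ab_group_add"
  assumes "well_formed D"
  shows "total_fare \<phi> D f = (\<Sum>v\<in>#D. \<Sum>e\<leftarrow>outgoing v. \<phi> (f (arc_of D e)))"
proof -
  have "total_fare \<phi> D f = (\<Sum>e\<in>initial_edges D. \<phi> (f (arc_of D e)))"
    unfolding total_fare_def semiarcs_eq[OF assms]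
    by (simp add: sum.reindex inj_on_arc_of assms)
  also have "\<dots> = (\<Sum>e\<in>#(\<Sum>v\<in>#D. mset (outgoing v)). \<phi> (f (arc_of D e)))"
    by (simp add: sum_unfold_sum_mset mset_initial_edges assms)
  also have "(\<Sum>e\<in>#(\<Sum>v\<in>#D. mset (outgoing v)). g e) = (\<Sum>v\<in>#D. \<Sum>e\<leftarrow>outgoing v. g e)" for g :: "nat \<Rightarrow> 'b"
    by (induction D) (simp_all add: sum_mset_sum_list flip: mset_map)
  finally show ?thesis .
qed

lemma count_dart_mset_add_le:
  assumes "well_formed (M + L)"
  shows "count (dart_mset M) d + count (dart_mset L) d \<le> 1"
  using count_dart_mset_le[OF assms, of d] by (simp add: dart_mset_def)

text \<open>An interior edge uses up both of its darts inside the disc, and no dart occurs twice.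
  Its color can therefore be changed without affecting \<open>M\<close>.\<close>

lemma interior_edges_fresh:
  assumes "well_formed (M + L)" "\<And>e. e \<in> I \<Longrightarrow> Start e \<in># dart_mset L \<and> End e \<in># dart_mset L"
  shows "all_edges M \<inter> I = {}"
proof -
  have "e \<notin> all_edges M" if "e \<in> I" for e
  proof -
    have "0 < count (dart_mset L) (Start e)" "0 < count (dart_mset L) (End e)"
      using assms(2)[OF that] by simp_all
    then have "count (dart_mset M) (Start e) = 0" "count (dart_mset M) (End e) = 0"
      using count_dart_mset_add_le[OF assms(1), of "Start e"] count_dart_mset_add_le[OF assms(1), of "End e"]
      by linarith+
    then show ?thesis
      by (auto simp: all_edges_def set_vertex_rotation dart_mset_def not_in_iff[symmetric])
  qed
  then show ?thesis by blast
qed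

text \<open>The source of the inequalities between labels in each move. Only those involving an
  inner edge follow: two boundary edges may coincide, when an edge leaves the disc and
  returns.\<close>

lemma distinct_darts:
  assumes "well_formed (M + L)" "dart_mset L = mset ds"
  shows "distinct ds"
proof -
  have "count (mset ds) d \<le> 1" for d
    using count_dart_mset_add_le[OF assms(1), of d] assms(2) by simp
  then show ?thesis
    unfolding distinct_count_atmost_1
    by (metis One_nat_def count_greater_zero_iff le_antisym less_eq_Suc_le not_in_iff set_mset_mset)
qed

section \<open>Colorings of edges\<close>

context fare_biquandle
begin

fun vertex_colored :: "('e \<Rightarrow> 'x) \<Rightarrow> 'e vertex \<Rightarrow> bool" where
  "vertex_colored c (Cross k sw se ne nw) \<longleftrightarrow> crossing k (c sw) (c se) (c ne) (c nw)"
| "vertex_colored c (Joint a b) \<longleftrightarrow> c a = c b \<and> c b \<in> X"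
| "vertex_colored c (Tail a) \<longleftrightarrow> c a \<in> X"
| "vertex_colored c (Head a) \<longleftrightarrow> c a \<in> X"

definition colored :: "(nat \<Rightarrow> 'x) \<Rightarrow> diagram \<Rightarrow> bool" where
  "colored c D \<longleftrightarrow> (\<forall>v\<in>#D. vertex_colored c v)"

text \<open>The fixed value off the diagram makes this set finite and counts every coloring
  once.\<close>

definition edge_colorings :: "diagram \<Rightarrow> (nat \<Rightarrow> 'x) set" where
  "edge_colorings D = {c \<in> extensional (all_edges D). colored c D}"

definition edge_fare :: "(nat \<Rightarrow> 'x) \<Rightarrow> diagram \<Rightarrow> 'a" where
  "edge_fare c D = (\<Sum>v\<in>#D. \<Sum>e\<leftarrow>outgoing v. \<phi> (c e))"

lemma colored_simps [simp]:
  "colored c {#}" "colored c (add_mset v D) \<longleftrightarrow> vertex_colored c v \<and> colored c D"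
  "colored c (M + N) \<longleftrightarrow> colored c M \<and> colored c N"
  by (auto simp: colored_def)

lemma edge_fare_simps [simp]:
  "edge_fare c {#} = 0"
  "edge_fare c (add_mset v D) = (\<Sum>e\<leftarrow>outgoing v. \<phi> (c e)) + edge_fare c D"
  "edge_fare c (M + N) = edge_fare c M + edge_fare c N"
  by (simp_all add: edge_fare_def)

lemma vertex_colored_map: "vertex_colored c (map_vertex f v) \<longleftrightarrow> vertex_colored (c \<circ> f) v"
  by (cases v) simp_all

lemma outgoing_map: "outgoing (map_vertex f v) = map f (outgoing v)"
  by (cases v) simp_all

lemma colored_map: "colored c (image_mset (map_vertex f) D) \<longleftrightarrow> colored (c \<circ> f) D"
  by (simp add: colored_def vertex_colored_map)

lemma edge_fare_map: "edge_fare c (image_mset (map_vertex f) D) = edge_fare (c \<circ> f) D"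
  by (simp add: edge_fare_def outgoing_map multiset.map_comp comp_def)

lemma vertex_colored_cong:
  assumes "\<And>e. e \<in> set_vertex v \<Longrightarrow> c e = d e"
  shows "vertex_colored c v \<longleftrightarrow> vertex_colored d v"
  using assms by (cases v) simp_all

lemma colored_cong:
  assumes "\<And>e. e \<in> all_edges D \<Longrightarrow> c e = d e"
  shows "colored c D \<longleftrightarrow> colored d D"
  using assms vertex_colored_cong unfolding colored_def all_edges_def by (metis UN_I)

lemma set_outgoing_subset: "set (outgoing v) \<subseteq> set_vertex v"
  by (cases v) auto

lemma edge_fare_cong:
  assumes "\<And>e. e \<in> all_edges D \<Longrightarrow> c e = d e"
  shows "edge_fare c D = edge_fare d D"
proof -
  have "map (\<lambda>e. \<phi> (c e)) (outgoing v) = map (\<lambda>e. \<phi> (d e)) (outgoing v)" if "v \<in># D" for v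
  proof (rule map_cong)
    fix e assume "e \<in> set (outgoing v)"
    then have "e \<in> all_edges D"
      using set_outgoing_subset[of v] that by (auto simp: all_edges_def)
    then show "\<phi> (c e) = \<phi> (d e)"
      by (simp add: assms)
  qed simp
  then show ?thesis
    unfolding edge_fare_def by (metis (mono_tags, lifting) image_mset_cong)
qed

lemma vertex_colored_closed: "vertex_colored c v \<Longrightarrow> e \<in> set_vertex v \<Longrightarrow> c e \<in> X"
  by (cases v) (auto dest: crossing_closed)

lemma colored_closed: "colored c D \<Longrightarrow> e \<in> all_edges D \<Longrightarrow> c e \<in> X"
  by (auto simp: colored_def all_edges_def dest: vertex_colored_closed)

lemma finite_edge_colorings: "finite (edge_colorings D)"
proof (rule finite_subset)
  show "edge_colorings D \<subseteq> all_edges D \<rightarrow>\<^sub>E X"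
    by (auto simp: edge_colorings_def PiE_def colored_closed)
qed (simp add: finite_PiE finite_X)

lemma vertex_colored_iff:
  "vertex_colored c v \<longleftrightarrow>
    (\<forall>e\<in>set_vertex v. c e \<in> X) \<and> (\<forall>(a, b)\<in>strand_passes v. c a = c b) \<and> crossing_rule X und ovr c v"
proof (cases v)
  case (Cross k sw se ne nw)
  then show ?thesis
    by (cases k) (auto simp: ovr_closed und_closed)
qed auto

lemma colored_iff:
  "colored c D \<longleftrightarrow> (\<forall>e\<in>all_edges D. c e \<in> X) \<and> (\<forall>(a, b)\<in>passes D. c a = c b) \<and>
    (\<forall>v\<in>#D. crossing_rule X und ovr c v)"
proof -
  have "(\<forall>(a, b)\<in>passes D. c a = c b) \<longleftrightarrow> (\<forall>v\<in>#D. \<forall>(a, b)\<in>strand_passes v. c a = c b)"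
    using passes_eq[of _ _ D] by fast
  then show ?thesis
    unfolding colored_def vertex_colored_iff all_edges_def by blast
qed

lemma crossing_rule_cong:
  assumes "\<And>e. e \<in> set_vertex v \<Longrightarrow> c e = d e"
  shows "crossing_rule X und ovr c v \<longleftrightarrow> crossing_rule X und ovr d v"
proof (cases v)
  case (Cross k sw se ne nw)
  with assms show ?thesis by (cases k) simp_all
qed auto

lemma equiv_hull_const:
  assumes "(a, b) \<in> equiv_hull r" "\<And>a b. (a, b) \<in> r \<Longrightarrow> c a = c b"
  shows "c a = c b"
  using assms(1) unfolding equiv_hull_def
  by (induction rule: rtrancl_induct) (auto dest: assms(2))

text \<open>A coloring of arcs is the same as a coloring of edges that is constant along passes;
  \<open>h\<close> pulls back along \<open>arc_of D\<close>.\<close>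

lemma fare_multiset_eq:
  assumes wf: "well_formed D"
  shows "fare_multiset X und ovr \<phi> D = {# edge_fare c D. c \<in># mset_set (edge_colorings D) #}"
proof -
  define h where "h f = (\<lambda>e\<in>all_edges D. f (arc_of D e))" for f :: "nat set \<Rightarrow> 'x"
  have E: "edges D = all_edges D" using wf by (rule edges_eq)
  have inj: "inj_on h (colorings X und ovr D)"
  proof (rule inj_onI)
    fix f g assume fg: "f \<in> colorings X und ovr D" "g \<in> colorings X und ovr D" "h f = h g"
    have "f (arc_of D e) = g (arc_of D e)" if "e \<in> all_edges D" for e
      using fun_cong[OF fg(3), of e] that by (simp add: h_def)
    with fg(1,2) show "f = g"
      unfolding colorings_def by (intro PiE_ext[of f "arcs D" "\<lambda>_. X" g]) (auto simp: arcs_eq E)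
  qed
  have "h ` colorings X und ovr D = edge_colorings D"
  proof (intro equalityI subsetI)
    fix c assume "c \<in> h ` colorings X und ovr D"
    then obtain f where f: "f \<in> arcs D \<rightarrow>\<^sub>E X" "c = h f"
      and rule: "\<forall>v\<in>#D. crossing_rule X und ovr (\<lambda>e. f (arc_of D e)) v"
      by (auto simp: colorings_def)
    have "arc_of D a = arc_of D b" if "(a, b) \<in> passes D" for a b
      using that by (simp add: arc_of_eq equiv_hull_def r_into_rtrancl)
    moreover have "f (arc_of D e) \<in> X" if "e \<in> all_edges D" for e
      using f(1) that by (auto simp: arcs_eq E)
    ultimately have "colored (\<lambda>e. f (arc_of D e)) D"
      using rule by (auto simp: colored_iff)
    then have "colored c D"
      using colored_cong[of D c "\<lambda>e. f (arc_of D e)"] by (simp add: f h_def)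
    then show "c \<in> edge_colorings D"
      by (simp add: edge_colorings_def f h_def)
  next
    fix c assume c: "c \<in> edge_colorings D"
    then have col: "colored c D" and ext: "c \<in> extensional (all_edges D)"
      by (simp_all add: edge_colorings_def)
    then have const: "c a = c b" if "(a, b) \<in> passes D" for a b
      using that by (auto simp: colored_iff)
    \<comment> \<open>Any edge of an arc may be chosen, since \<open>c\<close> is constant along
      passes.\<close>
    define f where "f = (\<lambda>s\<in>arcs D. c (SOME e. e \<in> s))"
    have f: "f (arc_of D e) = c e" if "e \<in> all_edges D" for e
    proof -
      have "(SOME e'. e' \<in> arc_of D e) \<in> arc_of D e"
        by (rule someI) (rule mem_arc_of)
      then have "(e, SOME e'. e' \<in> arc_of D e) \<in> equiv_hull (passes D)"
        by (simp add: arc_of_def)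
      then have "c e = c (SOME e'. e' \<in> arc_of D e)"
        by (rule equiv_hull_const) (rule const)
      with that show ?thesis
        by (simp add: f_def arcs_eq E)
    qed
    have "f \<in> arcs D \<rightarrow>\<^sub>E X"
    proof (rule PiE_I)
      fix s assume "s \<in> arcs D"
      then show "f s \<in> X"
        using f colored_closed[OF col] by (auto simp: arcs_eq E)
    qed (simp add: f_def)
    moreover have "crossing_rule X und ovr (\<lambda>e. f (arc_of D e)) v" if "v \<in># D" for v
    proof -
      have "set_vertex v \<subseteq> all_edges D"
        using that by (auto simp: all_edges_def)
      then show ?thesis
        using col that crossing_rule_cong[of v "\<lambda>e. f (arc_of D e)" c] f
        by (auto simp: colored_iff)
    qed
    ultimately have "f \<in> colorings X und ovr D"
      by (simp add: colorings_def)
    moreover have "h f = c"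
      using ext f by (auto simp: h_def extensional_def)
    ultimately show "c \<in> h ` colorings X und ovr D"
      by blast
  qed
  then have "mset_set (edge_colorings D) = image_mset h (mset_set (colorings X und ovr D))"
    by (simp add: image_mset_mset_set inj)
  moreover have "total_fare \<phi> D = (\<lambda>f. edge_fare (h f) D)"
  proof
    fix f
    show "total_fare \<phi> D f = edge_fare (h f) D"
      using edge_fare_cong[of D "h f" "\<lambda>e. f (arc_of D e)"]
      by (simp add: total_fare_eq[OF wf] edge_fare_def h_def)
  qed
  ultimately show ?thesis
    by (simp add: fare_multiset_def multiset.map_comp comp_def)
qed

definition edge_fares :: "diagram \<Rightarrow> 'a multiset" where
  "edge_fares D = {# edge_fare c D. c \<in># mset_set (edge_colorings D) #}"

text \<open>For the two sides \<open>L\<close> and \<open>R\<close> of a move, \<open>I\<close> and \<open>J\<close> stand for the edges in the interior of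
  the disc.\<close>

definition transfers :: "diagram \<Rightarrow> diagram \<Rightarrow> nat set \<Rightarrow> bool" where
  "transfers L R J \<longleftrightarrow> (\<forall>c. colored c L \<longrightarrow>
    (\<exists>d. colored d R \<and> (\<forall>e. e \<notin> J \<longrightarrow> d e = c e) \<and> edge_fare d R = edge_fare c L))"

definition determines :: "diagram \<Rightarrow> nat set \<Rightarrow> bool" where
  "determines L I \<longleftrightarrow> (\<forall>c d. colored c L \<longrightarrow> colored d L \<longrightarrow>
    (\<forall>e\<in>all_edges L - I. c e = d e) \<longrightarrow> (\<forall>e\<in>I. c e = d e))"

lemma all_edges_simps [simp]:
  "all_edges {#} = {}" "all_edges (add_mset v D) = set_vertex v \<union> all_edges D"
  "all_edges (M + N) = all_edges M \<union> all_edges N"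
  by (auto simp: all_edges_def)

lemma restrict_coloring:
  assumes "colored d D"
  shows "restrict d (all_edges D) \<in> edge_colorings D"
    and "edge_fare (restrict d (all_edges D)) D = edge_fare d D"
  using assms colored_cong[of D "restrict d (all_edges D)" d] edge_fare_cong[of D "restrict d (all_edges D)" d]
  by (simp_all add: edge_colorings_def)

text \<open>\<open>transfers\<close> provides a map \<open>g\<close> of colorings that preserves
  fares. It keeps all colors outside the interior, and these determine the coloring by
  \<open>determines\<close>, so it is injective. With an inclusion in each direction, the two maps
  need not be shown to be inverse to each other.\<close>

lemma edge_fares_mono:
  assumes tr: "transfers L R J" and det: "determines L I"
    and outer: "all_edges L - I = all_edges R - J"
    and fresh: "all_edges M \<inter> I = {}" "all_edges M \<inter> J = {}"
  shows "edge_fares (M + L) \<subseteq># edge_fares (M + R)"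
proof -
  have "\<exists>d. d \<in> edge_colorings (M + R) \<and> (\<forall>e\<in>all_edges M \<union> (all_edges L - I). d e = c e) \<and>
      edge_fare d (M + R) = edge_fare c (M + L)" if "c \<in> edge_colorings (M + L)" for c
  proof -
    from that have c: "colored c M" "colored c L"
      by (simp_all add: edge_colorings_def)
    from c(2) tr obtain d where d: "colored d R" "\<And>e. e \<notin> J \<Longrightarrow> d e = c e"
        "edge_fare d R = edge_fare c L"
      unfolding transfers_def by blast
    have M: "d e = c e" if "e \<in> all_edges M" for e
      using d(2) fresh(2) that by blast
    then have "colored d (M + R)"
      using c(1) d(1) colored_cong[of M d c] by simp
    moreover have "edge_fare d (M + R) = edge_fare c (M + L)"
      using d(3) edge_fare_cong[of M d c] M by simp
    moreover have "restrict d (all_edges (M + R)) e = c e" if "e \<in> all_edges M \<union> (all_edges L - I)" for e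
      using that d(2)[of e] fresh(2) unfolding outer by auto
    ultimately show ?thesis
      using restrict_coloring[of d "M + R"] by metis
  qed
  then obtain g where g: "\<And>c. c \<in> edge_colorings (M + L) \<Longrightarrow> g c \<in> edge_colorings (M + R)"
      "\<And>c e. c \<in> edge_colorings (M + L) \<Longrightarrow> e \<in> all_edges M \<union> (all_edges L - I) \<Longrightarrow> g c e = c e"
      "\<And>c. c \<in> edge_colorings (M + L) \<Longrightarrow> edge_fare (g c) (M + R) = edge_fare c (M + L)"
    by metis
  have inj: "inj_on g (edge_colorings (M + L))"
  proof (rule inj_onI)
    fix c d assume cd: "c \<in> edge_colorings (M + L)" "d \<in> edge_colorings (M + L)" "g c = g d"
    have eq: "c e = d e" if "e \<in> all_edges M \<union> (all_edges L - I)" for e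
      using g(2)[OF cd(1) that] g(2)[OF cd(2) that] cd(3) by simp
    moreover have "c e = d e" if "e \<in> I" for e
      using det cd(1,2) eq that unfolding determines_def edge_colorings_def by simp
    ultimately have "c e = d e" if "e \<in> all_edges (M + L)" for e
      using that by auto
    with cd(1,2) show "c = d"
      unfolding edge_colorings_def by (intro extensionalityI[of c "all_edges (M + L)" d]) simp_all
  qed
  have "edge_fares (M + L) = {# edge_fare (g c) (M + R). c \<in># mset_set (edge_colorings (M + L)) #}"
    unfolding edge_fares_def using g(3) finite_edge_colorings by (intro image_mset_cong) simp
  also have "\<dots> = {# edge_fare d (M + R). d \<in># mset_set (g ` edge_colorings (M + L)) #}"
    by (simp add: multiset.map_comp comp_def flip: image_mset_mset_set[OF inj])
  also have "\<dots> \<subseteq># edge_fares (M + R)"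
    unfolding edge_fares_def using g(1) finite_edge_colorings
    by (intro image_mset_subseteq_mono subset_imp_msubset_mset_set) auto
  finally show ?thesis .
qed

lemma edge_fares_eq:
  assumes "transfers L R J" "transfers R L I" "determines L I" "determines R J"
    and "all_edges L - I = all_edges R - J" "all_edges M \<inter> I = {}" "all_edges M \<inter> J = {}"
  shows "edge_fares (M + L) = edge_fares (M + R)"
  using edge_fares_mono[of L R J I M] edge_fares_mono[of R L I J M] assms
  by (auto intro: subset_mset.antisym)

text \<open>The relabelling \<open>f\<close> need not be injective; it suffices that every coloring
  of \<open>D\<close> factors through it. This covers the removal of a joint, which merges two edges
  of equal color.\<close>

lemma edge_fares_map:
  assumes into: "\<And>c. c \<in> edge_colorings D \<Longrightarrow> \<exists>d. \<forall>e\<in>all_edges D. d (f e) = c e"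
    and img: "all_edges D' = f ` all_edges D"
    and col: "\<And>d. colored d D' \<longleftrightarrow> colored (d \<circ> f) D"
    and fare: "\<And>d. edge_fare d D' = edge_fare (d \<circ> f) D"
  shows "edge_fares D = edge_fares D'"
proof -
  define h where "h d = restrict (d \<circ> f) (all_edges D)" for d :: "nat \<Rightarrow> 'x"
  have inj: "inj_on h (edge_colorings D')"
  proof (rule inj_onI)
    fix c d assume cd: "c \<in> edge_colorings D'" "d \<in> edge_colorings D'" "h c = h d"
    have "c (f e) = d (f e)" if "e \<in> all_edges D" for e
      using fun_cong[OF cd(3), of e] that by (simp add: h_def)
    with cd(1,2) show "c = d"
      unfolding edge_colorings_def img by (intro extensionalityI[of c "f ` all_edges D" d]) auto
  qed
  have "h ` edge_colorings D' = edge_colorings D"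
  proof (intro equalityI subsetI)
    fix c assume "c \<in> h ` edge_colorings D'"
    then obtain d where "colored d D'" "c = h d"
      by (auto simp: edge_colorings_def)
    then show "c \<in> edge_colorings D"
      using restrict_coloring(1)[of "d \<circ> f" D] by (simp add: col h_def)
  next
    fix c assume c: "c \<in> edge_colorings D"
    then obtain d where d: "\<And>e. e \<in> all_edges D \<Longrightarrow> d (f e) = c e"
      using into by blast
    have "colored (d \<circ> f) D"
      using c d colored_cong[of D "d \<circ> f" c] by (simp add: edge_colorings_def)
    then have "restrict d (all_edges D') \<in> edge_colorings D'"
      using restrict_coloring(1)[of d D'] by (simp add: col)
    moreover have "h (restrict d (all_edges D')) = c"
      using c d by (auto simp: h_def edge_colorings_def extensional_def img)
    ultimately show "c \<in> h ` edge_colorings D'"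
      by blast
  qed
  then have "mset_set (edge_colorings D) = image_mset h (mset_set (edge_colorings D'))"
    by (simp add: image_mset_mset_set inj)
  moreover have "edge_fare (h d) D = edge_fare d D'" for d
    using edge_fare_cong[of D "h d" "d \<circ> f"] by (simp add: fare h_def)
  ultimately show ?thesis
    by (simp add: edge_fares_def multiset.map_comp comp_def)
qed

lemma all_edges_map: "all_edges (image_mset (map_vertex f) D) = f ` all_edges D"
  by (auto simp: all_edges_def vertex.set_map)

lemma edge_fares_relabel:
  assumes "inj_on f (all_edges D)"
  shows "edge_fares D = edge_fares (image_mset (map_vertex f) D)"
proof (rule edge_fares_map[where f = f])
  show "\<exists>d. \<forall>e\<in>all_edges D. d (f e) = c e" for c :: "nat \<Rightarrow> 'x"
    using assms by (intro exI[of _ "c \<circ> the_inv_into (all_edges D) f"]) (simp add: the_inv_into_f_f)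
qed (simp_all add: all_edges_map colored_map edge_fare_map)

lemma edge_fares_unjoin:
  assumes "well_formed (M + {#Joint a b#})" "a \<noteq> b"
  shows "edge_fares (M + {#Joint a b#}) = edge_fares (image_mset (map_vertex (id(b := a))) M)"
proof -
  \<comment> \<open>Since \<open>a\<close> and \<open>b\<close> differ, \<open>a\<close> starts at a
    vertex other than the joint. So it occurs in \<open>M\<close>, which already forces its color
    into \<open>X\<close>.\<close>
  have "Start a \<in> darts (M + {#Joint a b#})"
    using edges_eq[OF assms(1)] by (auto simp: edges_def)
  with assms(2) have a: "a \<in> all_edges M"
    by (auto simp: darts_iff all_edges_def set_vertex_rotation)
  show ?thesis
  proof (rule edge_fares_map[where f = "id(b := a)"])
    show "\<exists>d. \<forall>e\<in>all_edges (M + {#Joint a b#}). d ((id(b := a)) e) = c e"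
      if "c \<in> edge_colorings (M + {#Joint a b#})" for c
      using that by (intro exI[of _ c]) (auto simp: edge_colorings_def)
    show "all_edges (image_mset (map_vertex (id(b := a))) M) = id(b := a) ` all_edges (M + {#Joint a b#})"
      using a by (auto simp: all_edges_map)
    show "colored d (image_mset (map_vertex (id(b := a))) M) \<longleftrightarrow> colored (d \<circ> id(b := a)) (M + {#Joint a b#})" for d
      using colored_closed[of "d \<circ> id(b := a)" M a] a assms(2) by (auto simp: colored_map)
  qed (simp add: edge_fare_map)
qed

section \<open>Moves\<close>

text \<open>With this form of the fare the kind of a crossing stays symbolic. From here on the
  relation \<open>crossing\<close> is used only through the lemmas on curls, bigons and triangles
  and through determination by neighboring edges.\<close>

lemma outgoing_out: "(\<Sum>e\<leftarrow>outgoing (Cross k sw se ne nw). \<phi> (c e)) = out k (c ne) (c nw)"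
  by (simp add: out_def)

declare outgoing.simps(1) [simp del] outgoing_out [simp] crossing.simps [simp del]

lemma edge_fares_interior:
  assumes wf: "well_formed (M + L)" "well_formed (M + R)"
    and tr: "transfers L R J" "transfers R L I" and det: "determines L I" "determines R J"
    and outer: "all_edges L - I = all_edges R - J"
    and "\<And>e. e \<in> I \<Longrightarrow> Start e \<in># dart_mset L \<and> End e \<in># dart_mset L"
    and "\<And>e. e \<in> J \<Longrightarrow> Start e \<in># dart_mset R \<and> End e \<in># dart_mset R"
  shows "edge_fares (M + L) = edge_fares (M + R)"
proof (rule edge_fares_eq[OF tr det outer])
  show "all_edges M \<inter> I = {}"
    using wf(1) assms(8) by (rule interior_edges_fresh)
  show "all_edges M \<inter> J = {}"
    using wf(2) assms(9) by (rule interior_edges_fresh)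
qed

text \<open>The form taken by the first and second moves. The side made of joints has no interior
  edges and no fare, so a coloring of the other side passes to it unchanged.\<close>

lemma edge_fares_joints:
  assumes wf: "well_formed (M + L)" "well_formed (M + R)"
    and complete: "\<And>f. colored f L \<Longrightarrow> \<exists>g. colored g R \<and> (\<forall>e. e \<notin> J \<longrightarrow> g e = f e)"
    and sound: "\<And>f. colored f R \<Longrightarrow> colored f L \<and> edge_fare f R = edge_fare f L"
    and det: "determines R J" and outer: "all_edges L = all_edges R - J"
    and inner: "\<And>e. e \<in> J \<Longrightarrow> Start e \<in># dart_mset R \<and> End e \<in># dart_mset R"
  shows "edge_fares (M + L) = edge_fares (M + R)"
proof (rule edge_fares_interior[where I = "{}" and J = J, OF wf _ _ _ det _ _ inner])
  show "transfers L R J"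
    unfolding transfers_def
  proof (intro allI impI)
    fix f assume "colored f L"
    then obtain g where g: "colored g R" "\<forall>e. e \<notin> J \<longrightarrow> g e = f e"
      using complete by blast
    then have "edge_fare g L = edge_fare f L"
      using outer by (intro edge_fare_cong) auto
    with g sound show "\<exists>d. colored d R \<and> (\<forall>e. e \<notin> J \<longrightarrow> d e = f e) \<and> edge_fare d R = edge_fare f L"
      by metis
  qed
  show "transfers R L {}"
    using sound unfolding transfers_def by metis
qed (use outer in \<open>auto simp: determines_def\<close>)

lemma edge_fares_R1_right:
  assumes wf: "well_formed (M + {#Joint a b#})" "well_formed (M + {#Cross k a c c b#})"
  shows "edge_fares (M + {#Joint a b#}) = edge_fares (M + {#Cross k a c c b#})"
proof (rule edge_fares_joints[where J = "{c}", OF wf])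
  have neq: "c \<noteq> a" "c \<noteq> b"
    using distinct_darts[OF wf(2), of "[End a, End c, Start c, Start b]"] by (auto simp: dart_mset_def)
  note [simp] = neq neq[symmetric]
  show "\<exists>g. colored g {#Cross k a c c b#} \<and> (\<forall>e. e \<notin> {c} \<longrightarrow> g e = f e)"
    if f: "colored f {#Joint a b#}" for f
  proof -
    from f obtain z where "crossing k (f a) z z (f b)"
      using ex_curl_right[of "f a" k] by auto
    then show ?thesis
      by (intro exI[of _ "f(c := z)"]) auto
  qed
  show "determines {#Cross k a c c b#} {c}"
    unfolding determines_def
  proof (intro allI impI)
    fix f g assume "colored f {#Cross k a c c b#}" "colored g {#Cross k a c c b#}"
      "\<forall>e\<in>all_edges {#Cross k a c c b#} - {c}. f e = g e"
    then show "\<forall>e\<in>{c}. f e = g e"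
      using crossing_west[of k "f a" "f c" "f c" "f b" "g c" "g c"] by auto
  qed
  show "all_edges {#Joint a b#} = all_edges {#Cross k a c c b#} - {c}"
    by auto
qed (auto simp: dart_mset_def dest: curl_right)

lemma edge_fares_R1_left:
  assumes wf: "well_formed (M + {#Joint a b#})" "well_formed (M + {#Cross k c a b c#})"
  shows "edge_fares (M + {#Joint a b#}) = edge_fares (M + {#Cross k c a b c#})"
proof (rule edge_fares_joints[where J = "{c}", OF wf])
  have neq: "c \<noteq> a" "c \<noteq> b"
    using distinct_darts[OF wf(2), of "[End c, End a, Start b, Start c]"] by (auto simp: dart_mset_def)
  note [simp] = neq neq[symmetric]
  show "\<exists>g. colored g {#Cross k c a b c#} \<and> (\<forall>e. e \<notin> {c} \<longrightarrow> g e = f e)"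
    if f: "colored f {#Joint a b#}" for f
  proof -
    from f obtain z where "crossing k z (f a) (f b) z"
      using ex_curl_left[of "f a" k] by auto
    then show ?thesis
      by (intro exI[of _ "f(c := z)"]) auto
  qed
  show "determines {#Cross k c a b c#} {c}"
    unfolding determines_def
  proof (intro allI impI)
    fix f g assume "colored f {#Cross k c a b c#}" "colored g {#Cross k c a b c#}"
      "\<forall>e\<in>all_edges {#Cross k c a b c#} - {c}. f e = g e"
    then show "\<forall>e\<in>{c}. f e = g e"
      using crossing_east[of k "f c" "f a" "f b" "f c" "g c" "g c"] by auto
  qed
  show "all_edges {#Joint a b#} = all_edges {#Cross k c a b c#} - {c}"
    by auto
qed (auto simp: dart_mset_def dest: curl_left)

lemma edge_fares_R2_parallel:
  fixes a b c d x y :: nat and k :: kind and L R :: diagram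
  defines "L \<equiv> {#Joint a b, Joint c d#}" and "R \<equiv> {#Cross k a c x y, Cross (opposite k) y x d b#}"
  assumes wf: "well_formed (M + L)" "well_formed (M + R)"
  shows "edge_fares (M + L) = edge_fares (M + R)"
proof (rule edge_fares_joints[where J = "{x, y}", OF wf])
  have neq: "x \<noteq> y" "a \<noteq> x" "a \<noteq> y" "b \<noteq> x" "b \<noteq> y" "c \<noteq> x" "c \<noteq> y" "d \<noteq> x" "d \<noteq> y"
    using distinct_darts[OF wf(2), of "[End a, End c, Start x, Start y, End y, End x, Start d, Start b]"]
    by (auto simp: R_def dart_mset_def)
  note [simp] = neq neq[symmetric]
  \<comment> \<open>Only one crossing has to be solved for the inner colors: since \<open>a\<close>,
    \<open>b\<close> and \<open>c\<close>, \<open>d\<close> agree in color, the other imposes the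
    same relation. The antiparallel moves solve it from the east and from the west.\<close>
  show "\<exists>g. colored g R \<and> (\<forall>e. e \<notin> {x, y} \<longrightarrow> g e = f e)" if f: "colored f L" for f
  proof -
    from f obtain z w where "crossing k (f a) (f c) z w"
      using ex_crossing_south[of "f a" "f c" k] by (auto simp: L_def)
    with f show ?thesis
      by (intro exI[of _ "f(x := z, y := w)"]) (auto simp: L_def R_def crossing_opposite)
  qed
  show "colored f L \<and> edge_fare f R = edge_fare f L" if "colored f R" for f
    using that bigon_parallel[of k "f a" "f c" "f x" "f y" "f d" "f b"] by (auto simp: L_def R_def)
  show "determines R {x, y}"
    unfolding determines_def
  proof (intro allI impI)
    fix f g assume "colored f R" "colored g R" "\<forall>e\<in>all_edges R - {x, y}. f e = g e"
    then show "\<forall>e\<in>{x, y}. f e = g e"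
      using crossing_south[of k "f a" "f c" "f x" "f y" "g x" "g y"] by (auto simp: R_def)
  qed
  show "all_edges L = all_edges R - {x, y}"
    by (auto simp: L_def R_def)
qed (auto simp: dart_mset_def R_def)

lemma edge_fares_R2_antiparallel_left:
  fixes a b c d x y :: nat and k :: kind and L R :: diagram
  defines "L \<equiv> {#Joint a b, Joint c d#}" and "R \<equiv> {#Cross k y a d x, Cross (opposite k) x c b y#}"
  assumes wf: "well_formed (M + L)" "well_formed (M + R)"
  shows "edge_fares (M + L) = edge_fares (M + R)"
proof (rule edge_fares_joints[where J = "{x, y}", OF wf])
  have neq: "x \<noteq> y" "a \<noteq> x" "a \<noteq> y" "b \<noteq> x" "b \<noteq> y" "c \<noteq> x" "c \<noteq> y" "d \<noteq> x" "d \<noteq> y"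
    using distinct_darts[OF wf(2), of "[End y, End a, Start d, Start x, End x, End c, Start b, Start y]"]
    by (auto simp: R_def dart_mset_def)
  note [simp] = neq neq[symmetric]
  show "\<exists>g. colored g R \<and> (\<forall>e. e \<notin> {x, y} \<longrightarrow> g e = f e)" if f: "colored f L" for f
  proof -
    from f obtain z w where "crossing k w (f a) (f c) z"
      using ex_crossing_east[of "f a" "f c" k] by (auto simp: L_def)
    with f show ?thesis
      by (intro exI[of _ "f(x := z, y := w)"]) (auto simp: L_def R_def crossing_opposite)
  qed
  show "colored f L \<and> edge_fare f R = edge_fare f L" if "colored f R" for f
    using that bigon_antiparallel_left[of k "f y" "f a" "f d" "f x" "f c" "f b"] by (auto simp: L_def R_def)
  show "determines R {x, y}"
    unfolding determines_def
  proof (intro allI impI)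
    fix f g assume "colored f R" "colored g R" "\<forall>e\<in>all_edges R - {x, y}. f e = g e"
    then show "\<forall>e\<in>{x, y}. f e = g e"
      using crossing_east[of k "f y" "f a" "f d" "f x" "g y" "g x"] by (auto simp: R_def)
  qed
  show "all_edges L = all_edges R - {x, y}"
    by (auto simp: L_def R_def)
qed (auto simp: dart_mset_def R_def)

lemma edge_fares_R2_antiparallel_right:
  fixes a b c d x y :: nat and k :: kind and L R :: diagram
  defines "L \<equiv> {#Joint a b, Joint c d#}" and "R \<equiv> {#Cross k a y x d, Cross (opposite k) c x y b#}"
  assumes wf: "well_formed (M + L)" "well_formed (M + R)"
  shows "edge_fares (M + L) = edge_fares (M + R)"
proof (rule edge_fares_joints[where J = "{x, y}", OF wf])
  have neq: "x \<noteq> y" "a \<noteq> x" "a \<noteq> y" "b \<noteq> x" "b \<noteq> y" "c \<noteq> x" "c \<noteq> y" "d \<noteq> x" "d \<noteq> y"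
    using distinct_darts[OF wf(2), of "[End a, End y, Start x, Start d, End c, End x, Start y, Start b]"]
    by (auto simp: R_def dart_mset_def)
  note [simp] = neq neq[symmetric]
  show "\<exists>g. colored g R \<and> (\<forall>e. e \<notin> {x, y} \<longrightarrow> g e = f e)" if f: "colored f L" for f
  proof -
    from f obtain z w where "crossing k (f a) w z (f c)"
      using ex_crossing_west[of "f a" "f c" k] by (auto simp: L_def)
    with f show ?thesis
      by (intro exI[of _ "f(x := z, y := w)"]) (auto simp: L_def R_def crossing_opposite)
  qed
  show "colored f L \<and> edge_fare f R = edge_fare f L" if "colored f R" for f
    using that bigon_antiparallel_right[of k "f a" "f y" "f x" "f d" "f c" "f b"] by (auto simp: L_def R_def)
  show "determines R {x, y}"
    unfolding determines_def
  proof (intro allI impI)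
    fix f g assume "colored f R" "colored g R" "\<forall>e\<in>all_edges R - {x, y}. f e = g e"
    then show "\<forall>e\<in>{x, y}. f e = g e"
      using crossing_west[of k "f a" "f y" "f x" "f d" "g y" "g x"] by (auto simp: R_def)
  qed
  show "all_edges L = all_edges R - {x, y}"
    by (auto simp: L_def R_def)
qed (auto simp: dart_mset_def R_def)

lemma edge_fares_R3_braid:
  fixes a1 a2 a3 b1 b2 b3 p q r s t u :: nat and k12 k13 k23 :: kind and L R :: diagram
  defines "L \<equiv> {#Cross k12 a1 a2 p q, Cross k13 p a3 b1 r, Cross k23 q r b2 b3#}"
    and "R \<equiv> {#Cross k23 a2 a3 s t, Cross k13 a1 t u b3, Cross k12 u s b1 b2#}"
  assumes wf: "well_formed (M + L)" "well_formed (M + R)"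
    and kinds: "triangle_kinds k12 k23 (opposite k13)"
  shows "edge_fares (M + L) = edge_fares (M + R)"
proof (rule edge_fares_interior[where I = "{p, q, r}" and J = "{s, t, u}", OF wf])
  have neq:
    "p \<noteq> q" "p \<noteq> r" "q \<noteq> r" "p \<noteq> a1" "p \<noteq> a2" "p \<noteq> a3"
    "p \<noteq> b1" "p \<noteq> b2" "p \<noteq> b3" "q \<noteq> a1" "q \<noteq> a2" "q \<noteq> a3"
    "q \<noteq> b1" "q \<noteq> b2" "q \<noteq> b3" "r \<noteq> a1" "r \<noteq> a2" "r \<noteq> a3"
    "r \<noteq> b1" "r \<noteq> b2" "r \<noteq> b3"
    using distinct_darts[OF wf(1), of "[End a1, End a2, Start p, Start q, End p, End a3, Start b1, Start r, End q, End r, Start b2, Start b3]"]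
    by (auto simp: L_def dart_mset_def)
  have neq':
    "s \<noteq> t" "s \<noteq> u" "t \<noteq> u" "s \<noteq> a1" "s \<noteq> a2" "s \<noteq> a3"
    "s \<noteq> b1" "s \<noteq> b2" "s \<noteq> b3" "t \<noteq> a1" "t \<noteq> a2" "t \<noteq> a3"
    "t \<noteq> b1" "t \<noteq> b2" "t \<noteq> b3" "u \<noteq> a1" "u \<noteq> a2" "u \<noteq> a3"
    "u \<noteq> b1" "u \<noteq> b2" "u \<noteq> b3"
    using distinct_darts[OF wf(2), of "[End a2, End a3, Start s, Start t, End a1, End t, Start u, Start b3, End u, End s, Start b1, Start b2]"]
    by (auto simp: R_def dart_mset_def)
  note [simp] = neq neq[symmetric] neq' neq'[symmetric]
  show "transfers L R {s, t, u}"
    unfolding transfers_def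
  proof (intro allI impI)
    fix f assume f: "colored f L"
    then obtain s' t' u' where "crossing k23 (f a2) (f a3) s' t'" "crossing k13 (f a1) t' u' (f b3)"
      "crossing k12 u' s' (f b1) (f b2)"
      "out k23 s' t' + out k13 u' (f b3) + out k12 (f b1) (f b2) =
       out k12 (f p) (f q) + out k13 (f b1) (f r) + out k23 (f b2) (f b3)"
      using braid_right[OF kinds, of "f a1" "f a2" "f p" "f q" "f a3" "f b1" "f r" "f b2" "f b3"]
      by (auto simp: L_def)
    then show "\<exists>d. colored d R \<and> (\<forall>e. e \<notin> {s, t, u} \<longrightarrow> d e = f e) \<and> edge_fare d R = edge_fare f L"
      by (intro exI[of _ "f(s := s', t := t', u := u')"]) (auto simp: L_def R_def add_ac)
  qed
  show "transfers R L {p, q, r}"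
    unfolding transfers_def
  proof (intro allI impI)
    fix f assume f: "colored f R"
    then obtain p' q' r' where "crossing k12 (f a1) (f a2) p' q'" "crossing k13 p' (f a3) (f b1) r'"
      "crossing k23 q' r' (f b2) (f b3)"
      "out k12 p' q' + out k13 (f b1) r' + out k23 (f b2) (f b3) =
       out k23 (f s) (f t) + out k13 (f u) (f b3) + out k12 (f b1) (f b2)"
      using braid_left[OF kinds, of "f a2" "f a3" "f s" "f t" "f a1" "f u" "f b3" "f b1" "f b2"]
      by (auto simp: R_def)
    then show "\<exists>d. colored d L \<and> (\<forall>e. e \<notin> {p, q, r} \<longrightarrow> d e = f e) \<and> edge_fare d L = edge_fare f R"
      by (intro exI[of _ "f(p := p', q := q', r := r')"]) (auto simp: L_def R_def add_ac)
  qed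
  \<comment> \<open>The boundary edges to the south of the first crossing give \<open>p\<close> and
    \<open>q\<close>; those to the east of the second one give \<open>r\<close>.\<close>
  show "determines L {p, q, r}"
    unfolding determines_def
  proof (intro allI impI)
    fix f g assume "colored f L" "colored g L" "\<forall>e\<in>all_edges L - {p, q, r}. f e = g e"
    then show "\<forall>e\<in>{p, q, r}. f e = g e"
      using crossing_south[of k12 "f a1" "f a2" "f p" "f q" "g p" "g q"]
        crossing_east[of k13 "f p" "f a3" "f b1" "f r" "g p" "g r"]
      by (auto simp: L_def)
  qed
  show "determines R {s, t, u}"
    unfolding determines_def
  proof (intro allI impI)
    fix f g assume "colored f R" "colored g R" "\<forall>e\<in>all_edges R - {s, t, u}. f e = g e"
    then show "\<forall>e\<in>{s, t, u}. f e = g e"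
      using crossing_south[of k23 "f a2" "f a3" "f s" "f t" "g s" "g t"]
        crossing_north[of k12 "f u" "f s" "f b1" "f b2" "g u" "g s"]
      by (auto simp: R_def)
  qed
  show "all_edges L - {p, q, r} = all_edges R - {s, t, u}"
    by (auto simp: L_def R_def)
qed (auto simp: dart_mset_def L_def R_def)

lemma edge_fares_R3_alternating:
  fixes a1 a2 a3 b1 b2 b3 p q r s t u :: nat and k12 k23 k31 :: kind and L R :: diagram
  defines "L \<equiv> {#Cross k12 p a2 b1 q, Cross k23 q a3 b2 r, Cross k31 r a1 b3 p#}"
    and "R \<equiv> {#Cross k12 a1 t s b2, Cross k23 a2 u t b3, Cross k31 a3 s u b1#}"
  assumes wf: "well_formed (M + L)" "well_formed (M + R)"
    and kinds: "triangle_kinds k12 k23 k31"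
  shows "edge_fares (M + L) = edge_fares (M + R)"
proof (rule edge_fares_interior[where I = "{p, q, r}" and J = "{s, t, u}", OF wf])
  have neq:
    "p \<noteq> q" "p \<noteq> r" "q \<noteq> r" "p \<noteq> a1" "p \<noteq> a2" "p \<noteq> a3"
    "p \<noteq> b1" "p \<noteq> b2" "p \<noteq> b3" "q \<noteq> a1" "q \<noteq> a2" "q \<noteq> a3"
    "q \<noteq> b1" "q \<noteq> b2" "q \<noteq> b3" "r \<noteq> a1" "r \<noteq> a2" "r \<noteq> a3"
    "r \<noteq> b1" "r \<noteq> b2" "r \<noteq> b3"
    using distinct_darts[OF wf(1), of "[End p, End a2, Start b1, Start q, End q, End a3, Start b2, Start r, End r, End a1, Start b3, Start p]"]
    by (auto simp: L_def dart_mset_def)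
  have neq':
    "s \<noteq> t" "s \<noteq> u" "t \<noteq> u" "s \<noteq> a1" "s \<noteq> a2" "s \<noteq> a3"
    "s \<noteq> b1" "s \<noteq> b2" "s \<noteq> b3" "t \<noteq> a1" "t \<noteq> a2" "t \<noteq> a3"
    "t \<noteq> b1" "t \<noteq> b2" "t \<noteq> b3" "u \<noteq> a1" "u \<noteq> a2" "u \<noteq> a3"
    "u \<noteq> b1" "u \<noteq> b2" "u \<noteq> b3"
    using distinct_darts[OF wf(2), of "[End a1, End t, Start s, Start b2, End a2, End u, Start t, Start b3, End a3, End s, Start u, Start b1]"]
    by (auto simp: R_def dart_mset_def)
  note [simp] = neq neq[symmetric] neq' neq'[symmetric]
  show "transfers L R {s, t, u}"
    unfolding transfers_def
  proof (intro allI impI)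
    fix f assume f: "colored f L"
    then obtain s' t' u' where "crossing k12 (f a1) t' s' (f b2)" "crossing k23 (f a2) u' t' (f b3)"
      "crossing k31 (f a3) s' u' (f b1)"
      "out k12 s' (f b2) + out k23 t' (f b3) + out k31 u' (f b1) =
       out k12 (f b1) (f q) + out k23 (f b2) (f r) + out k31 (f b3) (f p)"
      using alternating_right[OF kinds, of "f p" "f a2" "f b1" "f q" "f a3" "f b2" "f r" "f a1" "f b3"]
      by (auto simp: L_def)
    then show "\<exists>d. colored d R \<and> (\<forall>e. e \<notin> {s, t, u} \<longrightarrow> d e = f e) \<and> edge_fare d R = edge_fare f L"
      by (intro exI[of _ "f(s := s', t := t', u := u')"]) (auto simp: L_def R_def add_ac)
  qed
  show "transfers R L {p, q, r}"
    unfolding transfers_def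
  proof (intro allI impI)
    fix f assume f: "colored f R"
    then obtain p' q' r' where "crossing k12 p' (f a2) (f b1) q'" "crossing k23 q' (f a3) (f b2) r'"
      "crossing k31 r' (f a1) (f b3) p'"
      "out k12 (f b1) q' + out k23 (f b2) r' + out k31 (f b3) p' =
       out k12 (f s) (f b2) + out k23 (f t) (f b3) + out k31 (f u) (f b1)"
      using alternating_left[OF kinds, of "f a1" "f t" "f s" "f b2" "f a2" "f u" "f b3" "f a3" "f b1"]
      by (auto simp: R_def)
    then show "\<exists>d. colored d L \<and> (\<forall>e. e \<notin> {p, q, r} \<longrightarrow> d e = f e) \<and> edge_fare d L = edge_fare f R"
      by (intro exI[of _ "f(p := p', q := q', r := r')"]) (auto simp: L_def R_def add_ac)
  qed
  \<comment> \<open>Every crossing has its boundary edges to the east here and to the west on the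
    other side, and two crossings already contain all three inner edges.\<close>
  show "determines L {p, q, r}"
    unfolding determines_def
  proof (intro allI impI)
    fix f g assume "colored f L" "colored g L" "\<forall>e\<in>all_edges L - {p, q, r}. f e = g e"
    then show "\<forall>e\<in>{p, q, r}. f e = g e"
      using crossing_east[of k12 "f p" "f a2" "f b1" "f q" "g p" "g q"]
        crossing_east[of k23 "f q" "f a3" "f b2" "f r" "g q" "g r"]
      by (auto simp: L_def)
  qed
  show "determines R {s, t, u}"
    unfolding determines_def
  proof (intro allI impI)
    fix f g assume "colored f R" "colored g R" "\<forall>e\<in>all_edges R - {s, t, u}. f e = g e"
    then show "\<forall>e\<in>{s, t, u}. f e = g e"
      using crossing_west[of k12 "f a1" "f t" "f s" "f b2" "g t" "g s"]
        crossing_west[of k23 "f a2" "f u" "f t" "f b3" "g u" "g t"]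
      by (auto simp: R_def)
  qed
  show "all_edges L - {p, q, r} = all_edges R - {s, t, u}"
    by (auto simp: L_def R_def)
qed (auto simp: dart_mset_def L_def R_def)

lemma edge_fares_local_move:
  assumes "local_move L R" "well_formed (M + L)" "well_formed (M + R)"
  shows "edge_fares (M + L) = edge_fares (M + R)"
  using assms
  by (cases rule: local_move.cases)
    (simp_all only: edge_fares_R1_right edge_fares_R1_left edge_fares_R2_parallel
      edge_fares_R2_antiparallel_left edge_fares_R2_antiparallel_right edge_fares_R3_braid
      edge_fares_R3_alternating)

lemma edge_fares_move:
  assumes "move D D'" "well_formed D" "well_formed D'"
  shows "edge_fares D = edge_fares D'"
  using assms(1)
proof cases
  case (relabel f)
  then show ?thesis
    using edge_fares_relabel edges_eq[OF assms(2)] by simp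
next
  case (unjoin a b M)
  then show ?thesis
    using edge_fares_unjoin assms(2) by simp
next
  case (reidemeister L R M)
  then show ?thesis
    using edge_fares_local_move assms(2,3) by simp
qed

lemma fare_multiset_invariant:
  assumes "reidemeister_equivalent D D'"
  shows "fare_multiset X und ovr \<phi> D = fare_multiset X und ovr \<phi> D'"
  using assms unfolding reidemeister_equivalent_def
proof (induction rule: equivclp_induct)
  case (step D' D'')
  have "fare_multiset X und ovr \<phi> C = fare_multiset X und ovr \<phi> C'"
    if "oriented_diagram C" "oriented_diagram C'" "move C C'" for C C'
  proof -
    from that have wf: "well_formed C" "well_formed C'"
      by (simp_all add: oriented_diagram_def)
    with edge_fares_move[OF that(3) wf] show ?thesis
      by (simp add: fare_multiset_eq edge_fares_def)
  qed
  with step show ?case by metis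
qed simp

end

theorem theorem1:
  fixes X :: "'x set" and und ovr :: "'x \<Rightarrow> 'x \<Rightarrow> 'x"
    and \<phi> :: "'x \<Rightarrow> 'a::ab_group_add"
    and D D' :: diagram
  assumes "biquandle X und ovr" and "finite X"
    and "fare1 X und ovr \<phi>"
    and "oriented_diagram D" and "oriented_diagram D'"
    and "reidemeister_equivalent D D'"
  shows "fare_multiset X und ovr \<phi> D = fare_multiset X und ovr \<phi> D'"
proof -
  interpret fare_biquandle X und ovr \<phi>
    using assms(1-3) by (simp add: fare_biquandle_def fare_biquandle_axioms_def)
  show ?thesis
    using assms(6) by (rule fare_multiset_invariant)
qed

end
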